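(* There exists an absolute constant $D$ such that the following holds. Let $k\ge 1$ and $n$ be integers, let $\mathcal{F}\subseteq \binom{[n]}{k}$, and assume that $n\ge k^2/4+5k+D$. Then \[ \sum_{A\in \mathcal{F}}\frac{1}{\binom{n-i_{\mathcal{F}}(A)}{k-i_{\mathcal{F}}(A)}}\le 1. \] Moreover, equality holds if and only if $\mathcal{F}$ is a $c$-star for some $0\le c\le k$.
   Context: $\binom{[n]}{k}$ denotes the family of all $k$-element subsets of $[n]=\{1,\dots,n\}$. For $\mathcal{F}\subseteq\binom{[n]}{k}$ and $A\in\mathcal{F}$, $i_{\mathcal{F}}(A):=\min_{B\in\mathcal{F}}|A\cap B|$. A $c$-star is the family of all $k$-subsets of $[n]$ containing a fixed $c$-element set. *)

theory Defs
  imports Complex_Main "HOL-Library.Ramsey"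
begin

text \<open>
  The family of all \<open>k\<close>-element subsets of \<open>{1..n}\<close> is \<open>nsets {1..n} k\<close> from
  \<^theory>\<open>HOL-Library.Ramsey\<close>.
\<close>

text \<open>Meaningful for \<open>A \<in> F\<close> with \<open>F\<close> finite, so that the minimum ranges over a
  finite nonempty set; \<open>B = A\<close> is allowed.\<close>

definition min_inter :: "'a set set \<Rightarrow> 'a set \<Rightarrow> nat" where
  "min_inter F A = Min ((\<lambda>B. card (A \<inter> B)) ` F)"

definition is_star :: "nat \<Rightarrow> nat \<Rightarrow> nat \<Rightarrow> nat set set \<Rightarrow> bool" where
  "is_star n k c F \<longleftrightarrow>
     (\<exists>C \<subseteq> {1..n}. card C = c \<and> F = {A \<in> nsets {1..n} k. C \<subseteq> A})"

end

theory Submission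
  imports Defs
begin

text \<open>
  Compressing \<open>F\<close> to the left does not decrease the number of sets with \<open>i\<^sub>F(A) \<ge> t\<close>, for any
  \<open>t\<close>, so the weighted sum does not decrease and \<open>F\<close> may be taken left-shifted. Then Frankl's random
  walk method applies. Let \<open>u\<close> be the largest height that the walks of all members reach. A member
  with \<open>i\<^sub>F(A) = t\<close> reaches height \<open>2 * t - u\<close>, so by the reflection principle the levels
  \<open>t \<noteq> u\<close> contribute only \<open>O(1 / k)\<close>. If all members of level at least \<open>u\<close> have height at least \<open>u\<close>
  at two or more times, level \<open>u\<close> contributes \<open>O(1 / k)\<close> as well. Otherwise there is an \<open>r\<close>
  such that every member reaches height \<open>u + 1\<close> or has exactly \<open>u + r\<close> elements in \<open>{1..u + 2 * r}\<close>.
  For \<open>r = 0\<close> the family is contained in a star or level \<open>u\<close> misses a constant proportion of it, for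
  \<open>r \<ge> 2\<close> the level \<open>u\<close> contributes at most \<open>1 / 2 + O(1 / k)\<close>, and for \<open>r = 1\<close> the sum is at most
  \<open>((u + 9) * (k - u) + O(1)) / (n - u)\<close>, where the hypothesis on \<open>n\<close> is used to full strength.
\<close>

subsection \<open>Counting walks\<close>

text \<open>A set is read as a lattice walk that moves up at its elements and down elsewhere.
  Started at time \<open>a\<close>, the walk of \<open>A\<close> has height \<open>2 * card (A \<inter> {..t}) - (t - a)\<close> at time \<open>t\<close>
  (for \<open>A \<subseteq> {a<..}\<close>), written below without subtraction. The starting time varies only so
  that the first step of the walk can be removed in inductions.\<close>

definition reaches :: "nat \<Rightarrow> nat \<Rightarrow> nat set \<Rightarrow> bool" where
  "reaches a v A \<longleftrightarrow> (\<exists>m\<ge>a. v + m \<le> 2 * card (A \<inter> {..m}) + a)"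

definition revisits :: "nat \<Rightarrow> nat \<Rightarrow> nat set \<Rightarrow> bool" where
  "revisits a v A \<longleftrightarrow>
     (\<exists>m1\<ge>a. \<exists>m2>m1. v + m1 \<le> 2 * card (A \<inter> {..m1}) + a \<and> v + m2 \<le> 2 * card (A \<inter> {..m2}) + a)"

lemma finite_nsets_interval [simp]: "finite (nsets {a<..b::nat} k)" "finite (nsets {a..b::nat} k)"
  by (simp_all add: finite_imp_finite_nsets)

lemma card_nsets:
  assumes "finite X"
  shows "card (nsets X k) = card X choose k"
proof -
  have "nsets X k = {B. B \<subseteq> X \<and> card B = k}" using assms by (auto simp: nsets_def intro: finite_subset)
  then show ?thesis using n_subsets[OF assms] by simp
qed

lemma card_prefix_le:
  assumes "A \<in> nsets {a<..b::nat} k"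
  shows "card (A \<inter> {..m}) \<le> k" "card (A \<inter> {..m}) \<le> m - a"
proof -
  have "finite A" "card A = k" "A \<subseteq> {a<..b}" using assms by (auto simp: nsets_def)
  then show "card (A \<inter> {..m}) \<le> k" by (metis Int_lower1 card_mono)
  have "A \<inter> {..m} \<subseteq> {a<..m}" using \<open>A \<subseteq> _\<close> by auto
  then show "card (A \<inter> {..m}) \<le> m - a" using card_mono[of "{a<..m}"] by fastforce
qed

text \<open>The recursion behind both walk counts, by whether \<open>Suc a\<close> is an element:
  deleting it is injective on the sets that contain it, and the other sets already live on the
  shorter interval.\<close>

lemma card_filter_nsets_first_step:
  "card {A \<in> nsets {a<..a + Suc l} (Suc k). P A}
   \<le> card {A \<in> nsets {Suc a<..Suc a + l} k. P (insert (Suc a) A)}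
     + card {A \<in> nsets {Suc a<..Suc a + l} (Suc k). P A}" (is "card ?L \<le> card ?X + card ?Y")
proof -
  have "A \<in> insert (Suc a) ` ?X \<union> ?Y" if "A \<in> ?L" for A
  proof (cases "Suc a \<in> A")
    case True
    define B where "B = A - {Suc a}"
    have A: "A \<subseteq> {a<..a + Suc l}" "finite A" "card A = Suc k" "P A" using that by (auto simp: nsets_def)
    have B: "insert (Suc a) B = A" using True by (auto simp: B_def)
    have "B \<subseteq> {Suc a<..Suc a + l}"
    proof
      fix x assume "x \<in> B"
      then have "a < x" "x \<le> a + Suc l" "x \<noteq> Suc a" using A(1) by (auto simp: B_def)
      then show "x \<in> {Suc a<..Suc a + l}" by simp
    qed
    moreover have "card B = k" "finite B" using A True by (simp_all add: B_def)
    ultimately have "B \<in> ?X" using A(4) B by (simp add: nsets_def)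
    then show ?thesis using B by blast
  next
    case False
    have "A \<subseteq> {Suc a<..Suc a + l}"
    proof
      fix x assume "x \<in> A"
      then have "a < x" "x \<le> a + Suc l" "x \<noteq> Suc a" using that False by (auto simp: nsets_def)
      then show "x \<in> {Suc a<..Suc a + l}" by simp
    qed
    then show ?thesis using that by (simp add: nsets_def)
  qed
  then have "?L \<subseteq> insert (Suc a) ` ?X \<union> ?Y" by blast
  then have "card ?L \<le> card (insert (Suc a) ` ?X \<union> ?Y)" by (intro card_mono) auto
  also have "\<dots> \<le> card (insert (Suc a) ` ?X) + card ?Y" by (rule card_Un_le)
  also have "card (insert (Suc a) ` ?X) \<le> card ?X" by (rule card_image_le) auto
  finally show ?thesis by simp
qed

text \<open>A height is the number of elements passed minus the number of gaps passed, hence at most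
  the number of elements.\<close>

lemma reaches_le:
  assumes "A \<in> nsets {a<..b} k" "reaches a v A"
  shows "v \<le> k"
proof -
  obtain m where "m \<ge> a" "v + m \<le> 2 * card (A \<inter> {..m}) + a" using assms by (auto simp: reaches_def)
  then show ?thesis using card_prefix_le[OF assms(1), of m] by linarith
qed

lemma prefix_insert_first:
  assumes "A \<in> nsets {Suc a<..b} k" "m \<ge> Suc a"
  shows "card (insert (Suc a) A \<inter> {..m}) = Suc (card (A \<inter> {..m}))"
proof -
  have "insert (Suc a) A \<inter> {..m} = insert (Suc a) (A \<inter> {..m})" using assms by auto
  moreover have "Suc a \<notin> A" using assms by (auto simp: nsets_def)
  ultimately show ?thesis by simp
qed

lemma prefix_before_first:
  assumes "A \<in> nsets {Suc a<..b} k"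
  shows "card (A \<inter> {..a}) = 0" "card (insert (Suc a) A \<inter> {..a}) = 0"
proof -
  show "card (A \<inter> {..a}) = 0" using card_prefix_le(2)[OF assms, of a] by simp
  moreover have "insert (Suc a) A \<inter> {..a} = A \<inter> {..a}" by auto
  ultimately show "card (insert (Suc a) A \<inter> {..a}) = 0" by simp
qed

lemma reaches_insert_first:
  assumes "A \<in> nsets {Suc a<..b} k" "reaches a (Suc v) (insert (Suc a) A)"
  shows "reaches (Suc a) v A"
proof -
  obtain m where m: "m \<ge> a" "Suc v + m \<le> 2 * card (insert (Suc a) A \<inter> {..m}) + a"
    using assms by (auto simp: reaches_def)
  \<comment> \<open>At the starting time the height is 0, so a positive height is attained only
    after the first step.\<close>
  have "m \<noteq> a" using m prefix_before_first[OF assms(1)] by auto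
  then have "m \<ge> Suc a" using m by simp
  then show ?thesis using m prefix_insert_first[OF assms(1), of m] unfolding reaches_def
    by (intro exI[of _ m]) auto
qed

lemma reaches_skip_first:
  assumes "A \<in> nsets {Suc a<..b} k" "reaches a (Suc v) A"
  shows "reaches (Suc a) (Suc (Suc v)) A"
proof -
  obtain m where m: "m \<ge> a" "Suc v + m \<le> 2 * card (A \<inter> {..m}) + a"
    using assms by (auto simp: reaches_def)
  have "m \<noteq> a" using m prefix_before_first[OF assms(1)] by auto
  then have "m \<ge> Suc a" using m by simp
  then show ?thesis using m unfolding reaches_def
    by (intro exI[of _ m]) auto
qed

text \<open>The bound that the reflection principle gives, here by recursion on the first step.\<close>

lemma card_reaches:
  "card {A \<in> nsets {a<..a + l} (v + w). reaches a v A} \<le> l choose w"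
proof (induction l arbitrary: a v w)
  case 0
  have "card {A \<in> nsets {a<..a + 0} (v + w). reaches a v A} \<le> card (nsets {a<..a + 0} (v + w))"
    by (intro card_mono finite_nsets_interval) auto
  also have "\<dots> = 0 choose (v + w)" by (simp add: card_nsets)
  also have "\<dots> \<le> 0 choose w" by (cases "v + w") auto
  finally show ?case .
next
  case (Suc l)
  show ?case
  proof (cases v)
    case 0
    have "card {A \<in> nsets {a<..a + Suc l} (v + w). reaches a v A} \<le> card (nsets {a<..a + Suc l} w)"
      using 0 by (intro card_mono) auto
    then show ?thesis by (simp add: card_nsets)
  next
    case (Suc v')
    let ?N = "\<lambda>k. nsets {Suc a<..Suc a + l} k"
    have "card {A \<in> nsets {a<..a + Suc l} (v + w). reaches a v A} \<le>
       card {A \<in> ?N (v' + w). reaches a v (insert (Suc a) A)} + card {A \<in> ?N (v + w). reaches a v A}"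
      using card_filter_nsets_first_step[of a l "v' + w" "reaches a v"] Suc by simp
    also have "card {A \<in> ?N (v' + w). reaches a v (insert (Suc a) A)}
        \<le> card {A \<in> ?N (v' + w). reaches (Suc a) v' A}"
      using reaches_insert_first Suc by (intro card_mono) auto
    also have "\<dots> \<le> l choose w" by (rule Suc.IH)
    also have "card {A \<in> ?N (v + w). reaches a v A} \<le> card {A \<in> ?N (v + w). reaches (Suc a) (Suc v) A}"
      using reaches_skip_first Suc by (intro card_mono) auto
    \<comment> \<open>A down-step raises the target by one while all \<open>v + w\<close> elements
      remain, so the lower index drops to \<open>w - 1\<close>, and Pascal's rule joins the two
      bounds. For \<open>w = 0\<close> the target exceeds the number of elements.\<close>
    also have "\<dots> \<le> (if w = 0 then 0 else l choose (w - 1))"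
    proof (cases w)
      case 0
      have "\<not> reaches (Suc a) (Suc v) A" if "A \<in> ?N (v + w)" for A
        using reaches_le[OF that, of "Suc v"] 0 by auto
      then have "{A \<in> ?N (v + w). reaches (Suc a) (Suc v) A} = {}" by blast
      then show ?thesis by (simp only: card.empty le0)
    next
      case (Suc w')
      then show ?thesis using Suc.IH[of "Suc a" "Suc v" w'] by simp
    qed
    finally show ?thesis by (cases w) auto
  qed
qed

lemma revisits_lt:
  assumes "A \<in> nsets {a<..b} k" "revisits a v A"
  shows "v < k"
proof -
  obtain m1 m2 where "m1 \<ge> a" "m2 > m1" "v + m1 \<le> 2 * card (A \<inter> {..m1}) + a"
    "v + m2 \<le> 2 * card (A \<inter> {..m2}) + a" using assms by (auto simp: revisits_def)
  then show ?thesis using card_prefix_le[OF assms(1), of m1] card_prefix_le[OF assms(1), of m2] by linarith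
qed

lemma revisits_insert_first:
  assumes "A \<in> nsets {Suc a<..b} k" "revisits a (Suc v) (insert (Suc a) A)"
  shows "revisits (Suc a) v A"
proof -
  obtain m1 m2 where m: "m1 \<ge> a" "m2 > m1" "Suc v + m1 \<le> 2 * card (insert (Suc a) A \<inter> {..m1}) + a"
    "Suc v + m2 \<le> 2 * card (insert (Suc a) A \<inter> {..m2}) + a"
    using assms by (auto simp: revisits_def)
  have "m1 \<noteq> a" using m prefix_before_first[OF assms(1)] by auto
  then have "m1 \<ge> Suc a" using m by simp
  moreover from this have "v + m1 \<le> 2 * card (A \<inter> {..m1}) + Suc a" "v + m2 \<le> 2 * card (A \<inter> {..m2}) + Suc a"
    using m prefix_insert_first[OF assms(1), of m1] prefix_insert_first[OF assms(1), of m2] by auto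
  ultimately show ?thesis using m(2) unfolding revisits_def by blast
qed

lemma revisits_skip_first:
  assumes "A \<in> nsets {Suc a<..b} k" "revisits a (Suc v) A"
  shows "revisits (Suc a) (Suc (Suc v)) A"
proof -
  obtain m1 m2 where m: "m1 \<ge> a" "m2 > m1" "Suc v + m1 \<le> 2 * card (A \<inter> {..m1}) + a"
    "Suc v + m2 \<le> 2 * card (A \<inter> {..m2}) + a"
    using assms by (auto simp: revisits_def)
  have "m1 \<noteq> a" using m prefix_before_first[OF assms(1)] by auto
  then have "m1 \<ge> Suc a" using m by simp
  moreover have "Suc (Suc v) + m1 \<le> 2 * card (A \<inter> {..m1}) + Suc a"
    "Suc (Suc v) + m2 \<le> 2 * card (A \<inter> {..m2}) + Suc a" using m by auto
  ultimately show ?thesis using m(2) unfolding revisits_def by blast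
qed

lemma revisits_0_reaches:
  assumes "revisits a 0 A"
  shows "reaches (Suc a) 1 A"
proof -
  obtain m1 m2 where "m1 \<ge> a" "m2 > m1" "m2 \<le> 2 * card (A \<inter> {..m2}) + a"
    using assms by (auto simp: revisits_def)
  then show ?thesis unfolding reaches_def by (intro exI[of _ m2]) auto
qed

text \<open>Demanding a second time at height \<open>v\<close> lowers the binomial index by one,
  just as demanding height \<open>Suc v\<close> does in \<open>card_reaches\<close>, at the price of
  a factor 2. The recursion is the same; the factor enters at \<open>v = 0\<close>.\<close>

lemma card_revisits:
  "card {A \<in> nsets {a<..a + l} (v + Suc w). revisits a v A} \<le> 2 * (l choose w)"
proof (induction l arbitrary: a v w)
  case 0
  have "{A \<in> nsets {a<..a + 0} (v + Suc w). revisits a v A} = {}" by (auto simp: nsets_def)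
  then show ?case by (metis card.empty le0)
next
  case (Suc l)
  let ?N = "\<lambda>k. nsets {Suc a<..Suc a + l} k"
  show ?case
  proof (cases v)
    case 0
    have "card {A \<in> nsets {a<..a + Suc l} (v + Suc w). revisits a v A} \<le>
       card {A \<in> ?N w. revisits a v (insert (Suc a) A)} + card {A \<in> ?N (Suc w). revisits a v A}"
      using card_filter_nsets_first_step[of a l "w" "revisits a v"] 0 by simp
    also have "card {A \<in> ?N w. revisits a v (insert (Suc a) A)} \<le> card (?N w)"
      by (intro card_mono) auto
    also have "\<dots> = l choose w" by (simp add: card_nsets)
    \<comment> \<open>After a down-step the walk is at height -1, so being at height 0 again means
      climbing by 1.\<close>
    also have "card {A \<in> ?N (Suc w). revisits a v A} \<le> card {A \<in> ?N (1 + w). reaches (Suc a) 1 A}"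
      using revisits_0_reaches 0 by (intro card_mono) auto
    also have "\<dots> \<le> l choose w" by (rule card_reaches)
    finally show ?thesis using binomial_right_mono[of l "Suc l" w] by simp
  next
    case (Suc v')
    have "card {A \<in> nsets {a<..a + Suc l} (v + Suc w). revisits a v A} \<le>
       card {A \<in> ?N (v' + Suc w). revisits a v (insert (Suc a) A)} + card {A \<in> ?N (v + Suc w). revisits a v A}"
      using card_filter_nsets_first_step[of a l "v' + Suc w" "revisits a v"] Suc by simp
    also have "card {A \<in> ?N (v' + Suc w). revisits a v (insert (Suc a) A)}
        \<le> card {A \<in> ?N (v' + Suc w). revisits (Suc a) v' A}"
      using revisits_insert_first Suc by (intro card_mono) auto
    also have "\<dots> \<le> 2 * (l choose w)" by (rule Suc.IH)
    also have "card {A \<in> ?N (v + Suc w). revisits a v A} \<le> card {A \<in> ?N (v + Suc w). revisits (Suc a) (Suc v) A}"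
      using revisits_skip_first Suc by (intro card_mono) auto
    also have "\<dots> \<le> (if w = 0 then 0 else 2 * (l choose (w - 1)))"
    proof (cases w)
      case 0
      have "\<not> revisits (Suc a) (Suc v) A" if "A \<in> ?N (v + Suc w)" for A
        using revisits_lt[OF that, of "Suc v"] 0 by auto
      then have "{A \<in> ?N (v + Suc w). revisits (Suc a) (Suc v) A} = {}" by blast
      then show ?thesis by (simp only: card.empty le0)
    next
      case (Suc w')
      then show ?thesis using Suc.IH[of "Suc a" "Suc v" w'] by simp
    qed
    finally show ?thesis by (cases w) auto
  qed
qed

subsection \<open>Left-shifting\<close>

lemma le_min_inter_iff:
  assumes "finite F" "F \<noteq> {}"
  shows "t \<le> min_inter F A \<longleftrightarrow> (\<forall>B\<in>F. t \<le> card (A \<inter> B))"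
  using assms by (simp add: min_inter_def)

definition left_shifted :: "nat set set \<Rightarrow> bool" where
  "left_shifted F \<longleftrightarrow> (\<forall>A\<in>F. \<forall>i j. 1 \<le> i \<longrightarrow> i < j \<longrightarrow> j \<in> A \<longrightarrow> i \<notin> A \<longrightarrow> insert i (A - {j}) \<in> F)"

lemma card_swap:
  assumes "finite A" "j \<in> A" "i \<notin> A"
  shows "card (insert i (A - {j})) = card A"
  using card.remove[of A j] assms by (simp add: card_insert_if)

text \<open>If the swap in \<open>A\<close> loses the element \<open>j\<close> of
  \<open>A \<inter> B\<close> without gaining \<open>i\<close>, then \<open>B\<close> can be swapped
  instead, and \<open>A\<close> meets the swapped \<open>B\<close> in the same set. This keeps the
  level at least \<open>t\<close> in the induction of
  \<open>left_shifted_prefix_sum\<close>.\<close>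

lemma left_shifted_levels:
  assumes F: "left_shifted F" and fin: "\<And>X. X \<in> F \<Longrightarrow> finite X"
    and A: "A \<in> F" "\<forall>B\<in>F. t \<le> card (A \<inter> B)"
    and ij: "1 \<le> i" "i < j" "j \<in> A" "i \<notin> A" and B: "B \<in> F"
  shows "t \<le> card (insert i (A - {j}) \<inter> B)"
proof (cases "j \<in> B \<and> i \<notin> B")
  case True
  then have "insert i (B - {j}) \<in> F" using F B ij by (auto simp: left_shifted_def)
  moreover have "insert i (A - {j}) \<inter> B = A \<inter> insert i (B - {j})" using True ij by auto
  ultimately show ?thesis using A by simp
next
  case False
  have f: "finite A" "finite B" using fin A B by auto
  consider "j \<notin> B" | "i \<in> B" "j \<in> B" using False by blast
  then have "card (A \<inter> B) \<le> card (insert i (A - {j}) \<inter> B)"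
  proof cases
    case 1
    then show ?thesis using f by (intro card_mono) auto
  next
    case 2
    have "insert i (A - {j}) \<inter> B = insert i ((A \<inter> B) - {j})" using 2 by auto
    moreover have "card \<dots> = card (A \<inter> B)" using 2 f ij by (intro card_swap) auto
    ultimately show ?thesis by simp
  qed
  then show ?thesis using A B by (meson le_trans)
qed

text \<open>If the two prefixes were sparse at every time, the largest common element \<open>x\<close> of \<open>A\<close> and
  \<open>B\<close> could be shifted to the largest gap \<open>y < x\<close> of \<open>A \<union> B\<close>: prefixes stay sparse, the
  intersection shrinks, and eventually it has fewer than \<open>t\<close> elements.\<close>

lemma left_shifted_prefix_sum:
  assumes F: "left_shifted F" "F \<subseteq> nsets {0<..n} k"
    and A: "A \<in> F" "\<forall>B\<in>F. t \<le> card (A \<inter> B)" and B: "B \<in> F"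
  shows "\<exists>m. m + t \<le> card (A \<inter> {..m}) + card (B \<inter> {..m})"
  using A
proof (induction "card (A \<inter> B)" arbitrary: A rule: less_induct)
  case less
  have fin: "finite X" "X \<subseteq> {0<..n}" if "X \<in> F" for X using that F by (auto simp: nsets_def)
  show ?case
  proof (rule ccontr)
    assume neg: "\<not> ?thesis"
    have Q: "card (A \<inter> {..m}) + card (B \<inter> {..m}) < m + t" for m using neg by (meson not_le)
    have "t > 0" using Q[of 0] by simp
    have r: "t \<le> card (A \<inter> B)" using less.prems B by blast
    then have ne: "A \<inter> B \<noteq> {}" using \<open>t > 0\<close> by auto
    define x where "x = Max (A \<inter> B)"
    have finAB: "finite (A \<inter> B)" "finite A" "finite B" using fin less.prems B by auto
    have x: "x \<in> A" "x \<in> B" using Max_in[OF finAB(1) ne] by (auto simp: x_def)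
    have xmax: "z \<le> x" if "z \<in> A \<inter> B" for z using that finAB by (simp add: x_def)
    have ie: "card (A \<inter> {..m}) + card (B \<inter> {..m}) = card (A \<inter> B \<inter> {..m}) + card ((A \<union> B) \<inter> {..m})" for m
    proof -
      have "(A \<inter> {..m}) \<union> (B \<inter> {..m}) = (A \<union> B) \<inter> {..m}" "(A \<inter> {..m}) \<inter> (B \<inter> {..m}) = A \<inter> B \<inter> {..m}" by auto
      then show ?thesis using card_Un_Int[of "A \<inter> {..m}" "B \<inter> {..m}"] by simp
    qed
    \<comment> \<open>All common elements are counted at \<open>x\<close>, so inclusion-exclusion
      leaves fewer than \<open>x\<close> elements of the union up to \<open>x\<close>, and a gap
      exists.\<close>
    have "A \<inter> B \<inter> {..x} = A \<inter> B" using xmax by auto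
    then have lt: "card ((A \<union> B) \<inter> {..x}) < x" using Q[of x] ie[of x] r by simp
    let ?M = "{y. 0 < y \<and> y \<le> x \<and> y \<notin> A \<union> B}"
    have "?M \<noteq> {}"
    proof
      assume "?M = {}"
      then have "{0<..x} \<subseteq> (A \<union> B) \<inter> {..x}" by auto
      then have "card {0<..x} \<le> card ((A \<union> B) \<inter> {..x})" by (intro card_mono) auto
      then show False using lt by simp
    qed
    define y where "y = Max ?M"
    have finM: "finite ?M" by (rule finite_subset[of _ "{..x}"]) auto
    have y: "0 < y" "y \<le> x" "y \<notin> A" "y \<notin> B" using Max_in[OF finM \<open>?M \<noteq> {}\<close>] by (auto simp: y_def)
    have ymax: "z \<in> A \<union> B" if "y < z" "z \<le> x" for z
    proof (rule ccontr)
      assume "z \<notin> A \<union> B"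
      then have "z \<in> ?M" using that by auto
      then have "z \<le> y" using finM by (simp add: y_def)
      then show False using that by simp
    qed
    have yx: "y < x" using x y by (cases "x = y") auto
    let ?A = "insert y (A - {x})"
    have A': "?A \<in> F" using F(1) less.prems yx y x by (auto simp: left_shifted_def)
    have lev: "\<forall>C\<in>F. t \<le> card (?A \<inter> C)"
      using left_shifted_levels[OF F(1) fin(1) less.prems] yx y x by auto
    have "?A \<inter> B = (A \<inter> B) - {x}" using y by auto
    then have "card (?A \<inter> B) < card (A \<inter> B)" using x finAB by (metis IntI card_Diff1_less)
    then obtain m where m: "m + t \<le> card (?A \<inter> {..m}) + card (B \<inter> {..m})" using less.hyps A' lev by blast
    show False
    \<comment> \<open>Only prefixes that contain \<open>y\<close> but not \<open>x\<close> gain an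
      element by the swap.\<close>
    proof (cases "y \<le> m \<and> m < x")
      case False
      have "card (?A \<inter> {..m}) \<le> card (A \<inter> {..m})"
      proof (cases "y \<le> m")
        case True
        then have "?A \<inter> {..m} = insert y ((A \<inter> {..m}) - {x})" using False by auto
        moreover have "card \<dots> = card (A \<inter> {..m})" using True False y x by (intro card_swap) auto
        ultimately show ?thesis by simp
      next
        case False
        then show ?thesis using finAB by (intro card_mono) auto
      qed
      then show False using m Q[of m] by linarith
    next
      case True
      have "?A \<inter> {..m} = insert y (A \<inter> {..m})" using True by auto
      then have 1: "card (?A \<inter> {..m}) = Suc (card (A \<inter> {..m}))" using y by simp
      have 2: "Suc (card (A \<inter> B \<inter> {..m})) \<le> card (A \<inter> B)"
      proof -
        have "x \<in> A \<inter> B" "x \<notin> A \<inter> B \<inter> {..m}" using x True by auto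
        then have "A \<inter> B \<inter> {..m} \<subset> A \<inter> B" by blast
        then show ?thesis using finAB psubset_card_mono by (metis Suc_leI)
      qed
      \<comment> \<open>As \<open>y\<close> is the largest gap, the union is full between
        \<open>m\<close> and \<open>x\<close>. So sparseness at \<open>x\<close> passes down to
        \<open>m\<close> with all of \<open>A \<inter> B\<close> still counted, and the common
        element \<open>x\<close> beyond \<open>m\<close> pays for the element gained.\<close>
      have "{m<..x} \<subseteq> A \<union> B"
      proof
        fix z assume "z \<in> {m<..x}"
        then show "z \<in> A \<union> B" using ymax[of z] True by simp
      qed
      then have "(A \<union> B) \<inter> {..x} = ((A \<union> B) \<inter> {..m}) \<union> {m<..x}" using True by (auto simp: not_le)
      then have 3: "card ((A \<union> B) \<inter> {..x}) = card ((A \<union> B) \<inter> {..m}) + (x - m)"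
        by (simp only:) (subst card_Un_disjoint, auto)
      have 4: "card (A \<inter> B) + card ((A \<union> B) \<inter> {..x}) < x + t"
        using Q[of x] ie[of x] \<open>A \<inter> B \<inter> {..x} = A \<inter> B\<close> by simp
      show False using m 1 2 3 4 ie[of m] True by linarith
    qed
  qed
qed

section \<open>Compression of a family\<close>

definition shift_set :: "nat \<Rightarrow> nat \<Rightarrow> nat set set \<Rightarrow> nat set \<Rightarrow> nat set" where
  "shift_set i j F A = (if j \<in> A \<and> i \<notin> A \<and> insert i (A - {j}) \<notin> F then insert i (A - {j}) else A)"

definition shift :: "nat \<Rightarrow> nat \<Rightarrow> nat set set \<Rightarrow> nat set set" where
  "shift i j F = shift_set i j F ` F"

lemma swap_inj:
  assumes "insert i (A - {j}) = insert i (B - {j})" "j \<in> A" "i \<notin> A" "j \<in> B" "i \<notin> B"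
  shows "A = B"
  using assms by (metis Diff_insert_absorb insert_Diff insert_absorb insert_Diff_single insert_commute)

text \<open>Images of moved sets lie outside \<open>F\<close>, images of the others inside, and the
  swap can be undone.\<close>

lemma inj_on_shift_set: "inj_on (shift_set i j F) F"
  by (rule inj_onI) (auto simp: shift_set_def split: if_splits intro: swap_inj)

lemma card_shift: "card (shift i j F) = card F"
  by (simp add: shift_def card_image inj_on_shift_set)

text \<open>A set that moves in \<open>G\<close> may be blocked in \<open>F\<close>, but only
  because its image already belongs to \<open>F\<close>, where that image stays fixed.\<close>

lemma shift_mono:
  assumes "G \<subseteq> F"
  shows "shift i j G \<subseteq> shift i j F"
proof
  fix X assume "X \<in> shift i j G"
  then obtain A where A: "A \<in> G" "X = shift_set i j G A" by (auto simp: shift_def)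
  consider "X \<in> F" "shift_set i j F X = X" | "A \<in> F" "shift_set i j F A = X"
    using A assms unfolding shift_set_def by (cases "X \<in> F"; auto split: if_splits)
  then show "X \<in> shift i j F" by cases (auto simp: shift_def image_iff intro: sym)
qed

text \<open>\<open>G\<close> and \<open>F\<close> are compressed separately, so that
  \<open>G\<close> can be a level of \<open>F\<close>. If both sets move or neither does, the size
  of the intersection is unchanged. If one moves and the other stays only because its swap is
  already present, that swap gives an old pair with the same intersection.\<close>

lemma card_shift_set_Int:
  assumes "\<And>A B. A \<in> G \<Longrightarrow> B \<in> F \<Longrightarrow> t \<le> card (A \<inter> B)"
    and fin: "\<And>A. A \<in> G \<Longrightarrow> finite A"
    and "X \<in> shift i j G" "Y \<in> shift i j F"
  shows "t \<le> card (X \<inter> Y)"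
proof -
  obtain A B where A: "A \<in> G" "X = shift_set i j G A" and B: "B \<in> F" "Y = shift_set i j F B"
    using assms by (auto simp: shift_def)
  let ?A = "insert i (A - {j})" and ?B = "insert i (B - {j})"
  have AB: "t \<le> card (A \<inter> B)" and finAB: "finite (A \<inter> B)" using assms A B by auto
  have fA: "finite A" using fin A by auto
  consider (none) "X = A" "Y = B"
    | (both) "X = ?A" "Y = ?B" "j \<in> A" "i \<notin> A" "j \<in> B" "i \<notin> B"
    | (left) "X = ?A" "Y = B" "j \<in> A" "i \<notin> A" "j \<in> B \<Longrightarrow> i \<notin> B \<Longrightarrow> ?B \<in> F"
    | (right) "X = A" "Y = ?B" "j \<in> B" "i \<notin> B" "j \<in> A \<Longrightarrow> i \<notin> A \<Longrightarrow> ?A \<in> G"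
    using A B by (auto simp: shift_set_def split: if_splits)
  then show ?thesis
  proof cases
    case none
    then show ?thesis using AB by simp
  next
    case both
    have "X \<inter> Y = insert i ((A \<inter> B) - {j})" using both by auto
    moreover have "card \<dots> = card (A \<inter> B)" using both finAB by (intro card_swap) auto
    ultimately show ?thesis using AB by simp
  next
    case left
    consider "j \<in> B" "i \<notin> B" | "j \<notin> B" | "j \<in> B" "i \<in> B" by blast
    then show ?thesis
    proof cases
      case 1
      have "X \<inter> Y = A \<inter> ?B" using left 1 by auto
      moreover have "?B \<in> F" using left 1 by simp
      ultimately show ?thesis using assms(1) A by metis
    next
      case 2
      have "card (A \<inter> B) \<le> card (X \<inter> Y)" using 2 left fA by (intro card_mono) auto
      then show ?thesis using AB by simp
    next
      case 3
      have "X \<inter> Y = insert i ((A \<inter> B) - {j})" using left 3 by auto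
      moreover have "card \<dots> = card (A \<inter> B)" using left 3 finAB by (intro card_swap) auto
      ultimately show ?thesis using AB by simp
    qed
  next
    case right
    consider "j \<in> A" "i \<notin> A" | "j \<notin> A" | "j \<in> A" "i \<in> A" by blast
    then show ?thesis
    proof cases
      case 1
      have "X \<inter> Y = ?A \<inter> B" using right 1 by auto
      moreover have "?A \<in> G" using right 1 by simp
      ultimately show ?thesis using assms(1) B by metis
    next
      case 2
      have "card (A \<inter> B) \<le> card (X \<inter> Y)" using 2 right fA by (intro card_mono) auto
      then show ?thesis using AB by simp
    next
      case 3
      have "X \<inter> Y = insert i ((A \<inter> B) - {j})" using right 3 by auto
      moreover have "card \<dots> = card (A \<inter> B)" using right 3 finAB by (intro card_swap) auto
      ultimately show ?thesis using AB by simp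
    qed
  qed
qed

lemma shift_subset_nsets:
  assumes "F \<subseteq> nsets {1..n} k" "1 \<le> i" "i < j"
  shows "shift i j F \<subseteq> nsets {1..n} k"
proof
  fix X assume "X \<in> shift i j F"
  then obtain A where A: "A \<in> F" "X = shift_set i j F A" by (auto simp: shift_def)
  then have *: "A \<subseteq> {1..n}" "finite A" "card A = k" using assms by (auto simp: nsets_def)
  show "X \<in> nsets {1..n} k"
  proof (cases "X = A")
    case True
    then show ?thesis using A assms by auto
  next
    case False
    then have "X = insert i (A - {j})" "j \<in> A" "i \<notin> A" using A by (auto simp: shift_set_def split: if_splits)
    then show ?thesis using * assms card_swap[of A j i] by (auto simp: nsets_def)
  qed
qed

text \<open>The termination measure for repeated compression.\<close>

lemma sum_shift_less:
  assumes "finite F" "\<And>X. X \<in> F \<Longrightarrow> finite X"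
    and "i < j" "A \<in> F" "j \<in> A" "i \<notin> A" "insert i (A - {j}) \<notin> F"
  shows "(\<Sum>X\<in>shift i j F. \<Sum>X) < (\<Sum>X\<in>F. \<Sum>X)"
proof -
  have swap: "\<Sum>(insert i (X - {j})) < \<Sum>X" if "X \<in> F" "j \<in> X" "i \<notin> X" for X
    using that assms sum.remove[of X j "\<lambda>x. x"] by simp
  have "(\<Sum>X\<in>shift i j F. \<Sum>X) = (\<Sum>X\<in>F. \<Sum>(shift_set i j F X))"
    by (simp add: shift_def sum.reindex inj_on_shift_set)
  also have "\<dots> < (\<Sum>X\<in>F. \<Sum>X)"
  proof (rule sum_strict_mono_ex1)
    show "\<forall>X\<in>F. \<Sum>(shift_set i j F X) \<le> \<Sum>X" using swap by (auto simp: shift_set_def intro: less_imp_le)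
    show "\<exists>X\<in>F. \<Sum>(shift_set i j F X) < \<Sum>X" using swap assms by (auto simp: shift_set_def)
  qed fact
  finally show ?thesis .
qed

subsection \<open>Binomial estimates\<close>

lemma choose_step: "real (Suc j) * real (n choose Suc j) = (real n - real j) * real (n choose j)"
proof (cases "j \<le> n")
  case True
  have "Suc j * (n choose Suc j) = (n - j) * (n choose j)"
    by (rule trans[OF binomial_absorption binomial_absorb_comp[symmetric]])
  then have "real (Suc j * (n choose Suc j)) = real ((n - j) * (n choose j))" by (rule arg_cong)
  then show ?thesis using True by (simp only: of_nat_mult of_nat_diff)
qed (simp add: binomial_eq_0)

text \<open>The quotient of the two coefficients is a product of \<open>w\<close> factors
  \<open>(a + t - j) / (a - j)\<close>, each at most \<open>1 + t / d\<close> because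
  \<open>a - j\<close> is at least \<open>d\<close>.\<close>

lemma choose_add_le_exp:
  assumes "0 < d" "w + d \<le> a"
  shows "real (a + t choose w) \<le> exp (real t * real w / real d) * real (a choose w)"
proof -
  have "real (a + t choose w) \<le> (1 + real t / real d) ^ w * real (a choose w)"
    using assms(2)
  proof (induction w)
    case (Suc w)
    have IH: "real (a + t choose w) \<le> (1 + real t / real d) ^ w * real (a choose w)" using Suc by simp
    have "real t / (real a - real w) \<le> real t / real d"
      using Suc.prems assms(1) by (intro divide_left_mono) auto
    then have "(real (a + t) - real w) / (real a - real w) \<le> 1 + real t / real d"
      using Suc.prems assms(1) by (simp add: field_simps)
    then have f: "real (a + t) - real w \<le> (1 + real t / real d) * (real a - real w)"
      using Suc.prems assms(1) by (simp add: pos_divide_le_eq)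
    have "real (Suc w) * real (a + t choose Suc w) = (real (a + t) - real w) * real (a + t choose w)"
      by (rule choose_step)
    also have "\<dots> \<le> ((1 + real t / real d) * (real a - real w)) * ((1 + real t / real d) ^ w * real (a choose w))"
      using f IH Suc.prems by (intro mult_mono) auto
    also have "\<dots> = (1 + real t / real d) ^ Suc w * ((real a - real w) * real (a choose w))" by simp
    also have "\<dots> = (1 + real t / real d) ^ Suc w * (real (Suc w) * real (a choose Suc w))"
      by (simp only: choose_step)
    finally have "real (Suc w) * real (a + t choose Suc w)
       \<le> real (Suc w) * ((1 + real t / real d) ^ Suc w * real (a choose Suc w))" by (simp only: mult_ac)
    then show ?case by (rule mult_left_le_imp_le) simp
  qed simp
  also have "(1 + real t / real d) ^ w \<le> exp (real t / real d) ^ w"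
    by (intro power_mono exp_ge_add_one_self) simp
  also have "exp (real t / real d) ^ w = exp (real t * real w / real d)"
    by (simp flip: exp_of_nat_mult add: mult.commute)
  finally show ?thesis by (simp add: mult_right_mono)
qed

text \<open>Lowering the index from \<open>Suc j\<close> to \<open>j\<close> multiplies the
  coefficient by \<open>Suc j / (n - j)\<close>, here at most \<open>w / m\<close>.\<close>

lemma choose_diff_le:
  assumes "0 < m" "w + m \<le> n" "e \<le> w"
  shows "real (n choose (w - e)) \<le> (real w / real m) ^ e * real (n choose w)"
  using assms(3)
proof (induction e)
  case (Suc e)
  define j where "j = w - Suc e"
  have j: "w - e = Suc j" using Suc.prems by (simp add: j_def)
  have IH: "real (n choose Suc j) \<le> (real w / real m) ^ e * real (n choose w)" using Suc j by simp
  have jn: "real n - real j \<ge> real m" "real (Suc j) \<le> real w"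
    using assms Suc.prems by (auto simp: j_def)
  have "real m * real (n choose j) \<le> (real n - real j) * real (n choose j)"
    using jn by (intro mult_right_mono) auto
  also have "\<dots> = real (Suc j) * real (n choose Suc j)" by (simp only: choose_step)
  also have "\<dots> \<le> real w * ((real w / real m) ^ e * real (n choose w))"
    using jn IH by (intro mult_mono) auto
  finally have "real (n choose j) \<le> real w / real m * ((real w / real m) ^ e * real (n choose w))"
    using assms(1) by (simp add: field_simps)
  then show ?case by (simp add: j_def)
qed simp

text \<open>This product and the next run over the same index, so that
  \<open>weight_prefix_prod\<close> can pair their factors.\<close>

lemma choose_upper_prod: "real (a + r choose r) = (\<Prod>j=1..r. (real a + real j) / real j)"
proof (induction r)
  case (Suc r)
  have "real (Suc r) * real (Suc (a + r) choose Suc r) = real (Suc (a + r)) * real (a + r choose r)"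
    by (metis Suc_times_binomial_eq of_nat_mult mult.commute)
  then have "real (Suc (a + r) choose Suc r) = real (Suc (a + r)) * real (a + r choose r) / real (Suc r)"
    by (simp add: field_simps)
  then show ?case using Suc.IH by (simp add: field_simps)
qed simp

lemma choose_both_prod:
  "real (b + r choose (w + r)) * (\<Prod>j=1..r. (real w + real j) / (real b + real j)) = real (b choose w)"
proof (induction r)
  case (Suc r)
  have "real (Suc (w + r)) * real (Suc (b + r) choose Suc (w + r)) = real (Suc (b + r)) * real (b + r choose (w + r))"
    by (metis Suc_times_binomial_eq of_nat_mult mult.commute)
  then have *: "real (Suc (b + r) choose Suc (w + r)) * real (Suc (w + r)) / real (Suc (b + r)) = real (b + r choose (w + r))"
    by (simp add: field_simps del: of_nat_Suc)
  have comm: "x * (p * (c / d)) = x * c / d * p" for x p c d :: real by simp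
  have "real (b + Suc r choose (w + Suc r)) * (\<Prod>j=1..Suc r. (real w + real j) / (real b + real j))
     = real (Suc (b + r) choose Suc (w + r))
       * ((\<Prod>j=1..r. (real w + real j) / (real b + real j)) * (real (Suc (w + r)) / real (Suc (b + r))))"
    by (simp del: binomial_Suc_Suc add: algebra_simps)
  also have "\<dots> = real (b choose w)" unfolding comm * by (rule Suc.IH)
  finally show ?case .
qed simp

lemma mult_le_quarter_square: "(x::real) * y \<le> (x + y)\<^sup>2 / 4"
  using zero_le_power2[of "x - y"] by (simp add: power2_eq_square algebra_simps)

text \<open>The case \<open>r = 1\<close> of the main argument, with \<open>v = k - u\<close> and \<open>m = n - k\<close>. Up to an error
  of order \<open>1 / (m + v)\<close> the left-hand side is \<open>(u + 9) * v / (m + v)\<close>, and \<open>(u + 8) * v \<le> (u + v + 8)\<^sup>2 / 4\<close>; this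
  is where the linear term \<open>5 * k\<close> in the bound on \<open>n\<close> is needed.\<close>

lemma critical_case_estimate:
  fixes u v m :: real
  assumes "0 \<le> u" "1 \<le> v" and m: "(u + v)\<^sup>2 / 4 + 4 * (u + v) + 100 \<le> m"
  defines "Y \<equiv> (u + 2) * v / (m + v) + 3 * (v / m)"
  shows "Y + Y * ((v + 1) / m) + 3 * (v / m) / (1 - v / m) < 1"
proof -
  define M where "M = m + v"
  define K where "K = u + v"
  have K: "K * K / 4 + 4 * K + 100 \<le> m" "0 \<le> K" using assms(1,2) m by (simp_all add: K_def power2_eq_square)
  have sq: "v\<^sup>2 / 4 \<le> (u + v)\<^sup>2 / 4" using assms(1,2) by (intro divide_right_mono power_mono) auto
  have mv: "v\<^sup>2 / 4 + 4 * v + 100 \<le> m"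
  proof -
    have "v\<^sup>2 / 4 + 4 * v + 100 \<le> (u + v)\<^sup>2 / 4 + 4 * (u + v) + 100"
      using assms(1) by (intro add_mono sq) auto
    then show ?thesis using m by (rule order_trans)
  qed
  have vv: "0 \<le> v * v" by simp
  have mv': "v * v / 4 + 4 * v + 100 \<le> m" using mv by (simp only: power2_eq_square)
  have mpos: "0 < m" "v < m" using mv' vv assms(2) by linarith+
  then have Mpos: "0 < M" using assms(2) by (simp add: M_def)
  \<comment> \<open>\<open>s\<close>, and \<open>q\<close> below, are the costs of passing to the
    common denominator \<open>M\<close>; they are at most 4 because \<open>m\<close> exceeds
    \<open>v * v / 4 + v\<close>.\<close>
  define s where "s = v * v / m"
  have s: "0 \<le> s" "s \<le> 4" using mv' vv mpos assms(2) by (simp_all add: s_def pos_divide_le_eq)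
  have "v / m * M = v + s" using mpos by (simp add: M_def s_def distrib_left)
  then have d1: "v / m = (v + s) / M" using Mpos by (simp add: eq_divide_eq)
  have "Y = ((u + 2) * v + 3 * (v + s)) / M"
    unfolding Y_def d1 M_def[symmetric] by (simp add: add_divide_distrib)
  also have "\<dots> \<le> ((u + 2) * v + 3 * v + 12) / M"
    using s Mpos by (intro divide_right_mono) auto
  finally have Y1: "Y \<le> ((u + 2) * v + 3 * v + 12) / M" .
  have "(u + 5) * v \<le> (u + v + 5)\<^sup>2 / 4" using mult_le_quarter_square[of "u + 5" v] by (simp only: add_ac)
  also have "\<dots> = K * K / 4 + 5 / 2 * K + 25 / 4" by (simp add: K_def power2_eq_square field_simps)
  also have "\<dots> \<le> m - 12" using K by linarith
  finally have "(u + 2) * v + 3 * v + 12 \<le> M" using assms(2) by (simp add: M_def algebra_simps)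
  then have "((u + 2) * v + 3 * v + 12) / M \<le> 1" using Mpos by simp
  then have Y2: "Y \<le> 1" using Y1 by linarith
  have "(v + 1) / m * M = v + s + 1 + v / m" using mpos by (simp add: M_def s_def field_simps)
  then have "(v + 1) / m = (v + s + 1 + v / m) / M" using Mpos by (simp add: eq_divide_eq)
  also have "\<dots> \<le> (v + 6) / M"
  proof (intro divide_right_mono)
    have "v / m \<le> 1" using mpos by simp
    then show "v + s + 1 + v / m \<le> v + 6" using s by linarith
  qed (use Mpos in simp)
  finally have d2: "(v + 1) / m \<le> (v + 6) / M" .
  have "Y * ((v + 1) / m) \<le> 1 * ((v + 1) / m)" using Y2 assms(2) mpos by (intro mult_right_mono) auto
  then have Y3: "Y * ((v + 1) / m) \<le> (v + 6) / M" using d2 by linarith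
  define q where "q = v * v / (m - v)"
  have q: "q \<le> 4" using mv' mpos assms(2) by (simp add: q_def pos_divide_le_eq)
  have "v / (m - v) * M = v + 2 * q" using mpos by (simp add: M_def q_def field_simps)
  then have "v / (m - v) = (v + 2 * q) / M" using Mpos by (simp add: eq_divide_eq)
  also have "\<dots> \<le> (v + 8) / M" using q Mpos by (intro divide_right_mono) auto
  finally have "v / (m - v) \<le> (v + 8) / M" .
  moreover have "3 * (v / m) / (1 - v / m) = 3 * (v / (m - v))" using mpos by (simp add: field_simps)
  ultimately have d3: "3 * (v / m) / (1 - v / m) \<le> 3 * ((v + 8) / M)" by linarith
  have "Y + Y * ((v + 1) / m) + 3 * (v / m) / (1 - v / m)
      \<le> ((u + 2) * v + 3 * v + 12) / M + (v + 6) / M + 3 * ((v + 8) / M)"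
    using Y1 Y3 d3 by linarith
  also have "\<dots> = (((u + 2) * v + 3 * v + 12) + (v + 6) + 3 * (v + 8)) / M"
    by (simp add: add_divide_distrib)
  also have "\<dots> < 1"
  proof -
    \<comment> \<open>The numerator is \<open>(u + 9) * v + 42\<close>. One \<open>v\<close> is
      absorbed by \<open>M = m + v\<close>, so \<open>(u + 8) * v + 42 < m\<close> remains, and the
      square produces exactly the linear term \<open>4 * K\<close>.\<close>
    have "(u + 8) * v \<le> (u + v + 8)\<^sup>2 / 4" using mult_le_quarter_square[of "u + 8" v] by (simp only: add_ac)
    also have "\<dots> = K * K / 4 + 4 * K + 16" by (simp add: K_def power2_eq_square field_simps)
    also have "\<dots> \<le> m - 84" using K by linarith
    finally have "((u + 2) * v + 3 * v + 12) + (v + 6) + 3 * (v + 8) < M" by (simp add: M_def algebra_simps)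
    then show ?thesis using Mpos by simp
  qed
  finally show ?thesis .
qed

text \<open>For \<open>t \<le> k\<close> this is the reciprocal of the size of a
  \<open>t\<close>-star.\<close>

definition weight :: "nat \<Rightarrow> nat \<Rightarrow> nat \<Rightarrow> real" where
  "weight n k t = 1 / real ((n - t) choose (k - t))"

locale large_ground_set =
  fixes n k :: nat
  assumes k_pos: "1 \<le> k"
    and n_large: "(real k)\<^sup>2 / 4 + 5 * real k + 10000000 \<le> real n"
begin

lemma n_ge: "2 * k + 1 \<le> n"
proof -
  have "0 \<le> (real k)\<^sup>2 / 4" by simp
  then have "2 * real k + 1 \<le> real n" using n_large by linarith
  then show ?thesis by linarith
qed

abbreviation m :: real where "m \<equiv> real (n - k)"

lemma m_eq: "m = real n - real k"
  using n_ge by (simp add: of_nat_diff)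

lemma m_large: "(real k)\<^sup>2 / 4 + 4 * real k + 10000000 \<le> m"
  using n_large by (simp add: m_eq)

lemma m_pos: "0 < m"
  using n_ge by simp

lemma k_over_m: "(real k + 1) / m \<le> 1 / 1000"
proof -
  \<comment> \<open>\<open>k * k / 4 - 1000 * k\<close> is smallest at \<open>k = 2000\<close>, with
    value -1000000, which the additive constant absorbs.\<close>
  have "0 \<le> (real k - 2000)\<^sup>2 / 4" by simp
  then have "1000 * (real k + 1) \<le> (real k)\<^sup>2 / 4 + 4 * real k + 10000000"
    by (simp add: power2_eq_square algebra_simps)
  then show ?thesis using m_large m_pos by (simp add: field_simps)
qed

lemma weight_pos: "0 < weight n k t" if "t \<le> k"
  using that n_ge by (simp add: weight_def zero_less_binomial_iff)

lemma weight_Suc: "weight n k t * (real n - real t) = weight n k (Suc t) * (real k - real t)" if "t < k"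
proof -
  have "(k - t) * ((n - t) choose (k - t)) = (n - t) * ((n - Suc t) choose (k - Suc t))"
    using times_binomial_minus1_eq[of "k - t" "n - t"] that by simp
  then have "real ((k - t) * ((n - t) choose (k - t))) = real ((n - t) * ((n - Suc t) choose (k - Suc t)))"
    by (rule arg_cong)
  then have "(real k - real t) * real ((n - t) choose (k - t)) = (real n - real t) * real ((n - Suc t) choose (k - Suc t))"
    using that n_ge by (simp add: of_nat_diff)
  moreover have "0 < (n - t) choose (k - t)" "0 < (n - Suc t) choose (k - Suc t)"
    using n_ge that by (simp_all add: zero_less_binomial_iff)
  ultimately show ?thesis unfolding weight_def by (simp add: field_simps)
qed

lemma weight_less_Suc: "weight n k t < weight n k (Suc t)" if "t < k"
proof -
  have "weight n k (Suc t) * (real k - real t) < weight n k (Suc t) * (real n - real t)"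
    using that n_ge weight_pos[of "Suc t"] by (intro mult_strict_left_mono) auto
  moreover have "real n - real t > 0" using that n_ge by simp
  ultimately show ?thesis using weight_Suc[OF that]
    by (metis mult.commute mult_less_cancel_left_pos)
qed

lemma weight_strict_mono: "weight n k s < weight n k t" if "s < t" "t \<le> k"
  using that
proof (induction t)
  case (Suc t)
  then show ?case using weight_less_Suc[of t] by (cases "s = t") auto
qed simp

lemma weight_mono: "weight n k s \<le> weight n k t" if "s \<le> t" "t \<le> k"
  using weight_strict_mono[of s t] that by (cases "s = t") auto

text \<open>Makes the levels below \<open>u\<close> an error term: one level down already costs a
  factor of order \<open>(k - u) / m\<close>.\<close>

lemma weight_pred: "weight n k (u - 1) \<le> weight n k u * ((real (k - u) + 1) / m)" if "1 \<le> u" "u \<le> k"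
proof -
  have *: "weight n k (u - 1) * (real n - real u + 1) = weight n k u * (real (k - u) + 1)"
    using weight_Suc[of "u - 1"] that by (simp add: of_nat_diff algebra_simps)
  have "m \<le> real n - real u + 1" using that by (simp add: m_eq)
  then have "weight n k (u - 1) * m \<le> weight n k (u - 1) * (real n - real u + 1)"
    using weight_pos[of "u - 1"] that by (intro mult_left_mono) (simp_all add: less_imp_le)
  then have "weight n k (u - 1) * m \<le> weight n k u * (real (k - u) + 1)" by (simp only: *)
  then show ?thesis using m_pos by (simp add: field_simps)
qed

text \<open>By AM-GM the product is at most \<open>k * k / 4\<close>; this uses the quadratic term
  of \<open>n_large\<close>.\<close>

lemma prod_le_m: "real u * real w \<le> m" if "u + w \<le> k"
proof -
  have "real u * real w \<le> (real u + real w)\<^sup>2 / 4" by (rule mult_le_quarter_square)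
  also have "\<dots> \<le> (real k)\<^sup>2 / 4" using that by (intro divide_right_mono power_mono) auto
  finally show ?thesis using m_large by simp
qed

text \<open>The coefficient is the bound of \<open>card_reaches\<close> for height
  \<open>u + e\<close>. Replacing \<open>n\<close> by \<open>n - u\<close> costs at most
  \<open>exp 1\<close>, since \<open>u * (k - u) \<le> m\<close>, and each further unit of height
  gains a factor \<open>(k - u) / m\<close>.\<close>

lemma weight_reaches_estimate:
  assumes "u \<le> k" "e \<le> k - u"
  shows "weight n k u * real (n choose (k - u - e)) \<le> 3 * (real (k - u) / m) ^ e"
proof -
  have "real (n - u + u choose (k - u)) \<le> exp (real u * real (k - u) / m) * real ((n - u) choose (k - u))"
    using assms n_ge by (intro choose_add_le_exp) auto
  also have "exp (real u * real (k - u) / m) \<le> exp 1"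
    using prod_le_m[of u "k - u"] assms m_pos by (simp add: pos_divide_le_eq)
  also have "exp 1 \<le> (3::real)" by (rule exp_le)
  finally have 1: "real (n choose (k - u)) \<le> 3 * real ((n - u) choose (k - u))"
    using assms n_ge by (simp add: mult_right_mono)
  have "real (n choose (k - u - e)) \<le> (real (k - u) / m) ^ e * real (n choose (k - u))"
    using assms n_ge by (intro choose_diff_le) auto
  also have "\<dots> \<le> (real (k - u) / m) ^ e * (3 * real ((n - u) choose (k - u)))"
    using 1 by (intro mult_left_mono) auto
  finally show ?thesis using weight_pos[OF assms(1)] unfolding weight_def by (simp add: field_simps)
qed

text \<open>Of the sets in a \<open>u\<close>-star, at least the proportion 1/81 avoids
  \<open>k\<close> given points outside the centre. The exponent is at most 4 because
  \<open>k * k \<le> 4 * (n - 2 * k)\<close>, and 81 is the bound \<open>3 ^ 4\<close> for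
  \<open>exp 4\<close>.\<close>

lemma avoiding_estimate:
  assumes "u \<le> k"
  shows "real ((n - u) choose (k - u)) \<le> 81 * real ((n - u - k) choose (k - u))"
proof -
  have "real (n - u - k + k choose (k - u)) \<le> exp (real k * real (k - u) / real (n - 2 * k)) * real ((n - u - k) choose (k - u))"
    using assms n_ge by (intro choose_add_le_exp) auto
  also have "exp (real k * real (k - u) / real (n - 2 * k)) \<le> exp 4"
  proof -
    have "real k * real (k - u) \<le> real k * real k" by (intro mult_left_mono) auto
    also have "\<dots> \<le> 4 * real (n - 2 * k)"
      using n_large n_ge by (simp add: of_nat_diff power2_eq_square)
    finally show ?thesis using n_ge by (simp add: pos_divide_le_eq)
  qed
  also have "exp (4::real) = exp 1 ^ 4" by (simp flip: exp_of_nat_mult)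
  also have "\<dots> \<le> (3::real) ^ 4" by (intro power_mono exp_le) simp
  finally show ?thesis using assms n_ge by (simp add: mult_right_mono)
qed

text \<open>The left side bounds the weighted number of sets with exactly \<open>u + r\<close>
  elements in \<open>{1..u + 2 * r}\<close>. Enlarging the top of the second coefficient to
  \<open>n - u - r\<close> makes its quotient by the star size a product of \<open>r\<close>
  factors.\<close>

lemma weight_prefix_prod:
  assumes "u + r \<le> k"
  shows "weight n k u * real ((u + 2 * r choose r) * ((n - (u + 2 * r)) choose (k - (u + r))))
    \<le> (\<Prod>j=1..r. (real (u + r) + real j) * (real (k - u - r) + real j) / (real j * (real (n - u - r) + real j)))"
proof -
  define a b w where "a = u + r" and "b = n - u - r" and "w = k - u - r"
  have eqs: "u + 2 * r = a + r" "n - u = b + r" "k - u = w + r" "k - (u + r) = w"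
    using assms n_ge by (auto simp: a_def b_def w_def)
  have "(n - (u + 2 * r)) choose w \<le> b choose w" by (rule binomial_right_mono) (auto simp: b_def)
  then have "weight n k u * real ((a + r choose r) * ((n - (u + 2 * r)) choose w))
    \<le> weight n k u * (real (a + r choose r) * real (b choose w))"
    using weight_pos[of u] assms by (simp add: mult_left_mono)
  also have "\<dots> = (\<Prod>j=1..r. (real a + real j) / real j) * (\<Prod>j=1..r. (real w + real j) / (real b + real j))"
  proof -
    have "0 < b + r choose (w + r)" using assms n_ge by (auto simp: zero_less_binomial_iff b_def w_def)
    then show ?thesis
      by (simp add: weight_def eqs choose_upper_prod flip: choose_both_prod[of b r w])
  qed
  also have "\<dots> = (\<Prod>j=1..r. (real a + real j) * (real w + real j) / (real j * (real b + real j)))"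
    by (simp flip: prod.distrib)
  finally show ?thesis by (simp add: a_def b_def w_def mult_2 add_ac)
qed

lemma weight_prefix_one:
  assumes "u + 1 \<le> k"
  shows "weight n k u * real ((u + 2 choose 1) * ((n - (u + 2)) choose (k - (u + 1))))
    \<le> (real u + 2) * real (k - u) / real (n - u)"
  using weight_prefix_prod[of u 1] assms n_ge by (simp add: of_nat_diff algebra_simps)

text \<open>By AM-GM the factor with index \<open>j\<close> is at most
  \<open>(k * k / 4 + k * j + j * j) / (j * m)\<close>. This is at most 1 for all
  \<open>j \<le> r\<close>, and the factor \<open>j = 2\<close> contributes the 1/2.\<close>

lemma weight_prefix_ge_two:
  assumes "u + r \<le> k" "2 \<le> r"
  shows "weight n k u * real ((u + 2 * r choose r) * ((n - (u + 2 * r)) choose (k - (u + r)))) \<le> 1 / 2"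
proof -
  define f where "f j = (real (u + r) + real j) * (real (k - u - r) + real j) / (real j * (real (n - u - r) + real j))" for j
  have f: "0 \<le> f j \<and> f j \<le> ((real k)\<^sup>2 / 4 + real k * real j + real j * real j) / (real j * m)" if "j \<ge> 1" for j
  proof
    show "0 \<le> f j" by (simp add: f_def)
    have "(real (u + r) + real j) * (real (k - u - r) + real j) \<le> (real (u + r) + real j + (real (k - u - r) + real j))\<^sup>2 / 4"
      by (rule mult_le_quarter_square)
    also have "real (u + r) + real j + (real (k - u - r) + real j) = real k + 2 * real j"
      using assms by (simp add: of_nat_diff)
    also have "(real k + 2 * real j)\<^sup>2 / 4 = (real k)\<^sup>2 / 4 + real k * real j + real j * real j"
      by (simp add: power2_eq_square field_simps)
    finally show "f j \<le> ((real k)\<^sup>2 / 4 + real k * real j + real j * real j) / (real j * m)"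
      unfolding f_def using assms that n_ge by (intro frac_le mult_left_mono) auto
  qed
  have f1: "f j \<le> 1" if "1 \<le> j" "j \<le> r" for j
  proof -
    have "real k * real j + real j * real j \<le> real j * (4 * real k)"
    proof -
      have "real j * real j \<le> real j * real k" using that assms by (intro mult_left_mono) auto
      moreover have "0 \<le> real j * real k" by simp
      ultimately have "real j * real k + real j * real j \<le> 4 * (real j * real k)" by linarith
      then show ?thesis by (simp only: mult_ac)
    qed
    moreover have "1 * ((real k)\<^sup>2 / 4) \<le> real j * ((real k)\<^sup>2 / 4)" using that by (intro mult_right_mono) auto
    moreover have "real j * ((real k)\<^sup>2 / 4 + 4 * real k) \<le> real j * m" using m_large by (intro mult_left_mono) auto
    ultimately have "(real k)\<^sup>2 / 4 + real k * real j + real j * real j \<le> real j * m" by (simp add: algebra_simps)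
    then have "((real k)\<^sup>2 / 4 + real k * real j + real j * real j) / (real j * m) \<le> 1"
      using that m_pos by (simp add: pos_divide_le_eq)
    with f[OF that(1)] show ?thesis by (meson order_trans)
  qed
  have "f 2 \<le> ((real k)\<^sup>2 / 4 + real k * 2 + 4) / (2 * m)" using f[of 2] by simp
  also have "\<dots> \<le> 1 / 2" using m_large m_pos by (simp add: field_simps)
  finally have f2: "f 2 \<le> 1 / 2" .
  have "(\<Prod>j=1..r. f j) = f 2 * (\<Prod>j\<in>{1..r} - {2}. f j)" using assms by (intro prod.remove) auto
  also have "\<dots> \<le> 1 / 2 * 1" using f f1 f2 by (intro mult_mono prod_le_1 prod_nonneg) auto
  finally show ?thesis using weight_prefix_prod[OF assms(1)] by (simp add: f_def)
qed

end

subsection \<open>Reduction to left-shifted families\<close>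

definition level_sum :: "nat \<Rightarrow> nat \<Rightarrow> nat set set \<Rightarrow> real" where
  "level_sum n k F = (\<Sum>A\<in>F. weight n k (min_inter F A))"

lemma finite_family:
  fixes n :: nat
  assumes "F \<subseteq> nsets {1..n} k"
  shows "finite F"
  using assms finite_imp_finite_nsets[OF finite_atLeastAtMost] by (rule finite_subset)

lemma min_inter_le_card:
  fixes n :: nat
  assumes "F \<subseteq> nsets {1..n} k" "A \<in> F"
  shows "min_inter F A \<le> k"
proof -
  have "F \<noteq> {}" using assms(2) by auto
  then have "min_inter F A \<le> card (A \<inter> A)"
    using le_min_inter_iff[OF finite_family[OF assms(1)], of "min_inter F A" A] assms(2) by blast
  also have "\<dots> = k" using assms by (auto simp: nsets_def)
  finally show ?thesis .
qed

lemma weight_telescope: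
  assumes "i \<le> k"
  shows "weight n k i = weight n k 0 + (\<Sum>t=1..k. (weight n k t - weight n k (t - 1)) * (if t \<le> i then 1 else 0))"
proof -
  have "(\<Sum>t=1..k. (weight n k t - weight n k (t - 1)) * (if t \<le> i then 1 else 0))
      = (\<Sum>t=1..i. (weight n k t - weight n k (t - 1)) * (if t \<le> i then 1 else 0))"
    using assms by (intro sum.mono_neutral_right) auto
  also have "\<dots> = (\<Sum>t=Suc 0..i. weight n k t - weight n k (t - 1))" by (intro sum.cong) auto
  also have "\<dots> = weight n k i - weight n k 0" by (rule sum_telescope'') simp
  finally show ?thesis by simp
qed

text \<open>Summation by parts. As the weights increase with the level, it is enough to control the
  number of members of level at least \<open>t\<close> for each \<open>t\<close>.\<close>

lemma level_sum_layers:
  assumes "F \<subseteq> nsets {1..n} k"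
  shows "level_sum n k F = real (card F) * weight n k 0
    + (\<Sum>t=1..k. (weight n k t - weight n k (t - 1)) * real (card {A \<in> F. t \<le> min_inter F A}))"
proof -
  have ind: "(\<Sum>A\<in>F. if t \<le> min_inter F A then 1 else 0) = real (card {A \<in> F. t \<le> min_inter F A})" for t
    using finite_family[OF assms] by (simp flip: sum.inter_filter)
  have "level_sum n k F = (\<Sum>A\<in>F. weight n k 0
      + (\<Sum>t=1..k. (weight n k t - weight n k (t - 1)) * (if t \<le> min_inter F A then 1 else 0)))"
    unfolding level_sum_def using min_inter_le_card[OF assms] by (intro sum.cong refl weight_telescope)
  also have "\<dots> = real (card F) * weight n k 0
      + (\<Sum>t=1..k. \<Sum>A\<in>F. (weight n k t - weight n k (t - 1)) * (if t \<le> min_inter F A then 1 else 0))"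
    by (simp only: sum.distrib sum_constant) (simp only: sum.swap[of _ F])
  also have "\<dots> = real (card F) * weight n k 0
      + (\<Sum>t=1..k. (weight n k t - weight n k (t - 1)) * real (card {A \<in> F. t \<le> min_inter F A}))"
    by (simp only: ind flip: sum_distrib_left)
  finally show ?thesis .
qed

text \<open>The level, compressed on its own, keeps its size, lies in the compressed family by
  \<open>shift_mono\<close>, and still meets all of it in at least \<open>t\<close> elements by
  \<open>card_shift_set_Int\<close>.\<close>

lemma card_level_shift:
  assumes F: "F \<subseteq> nsets {1..n} k" and ij: "1 \<le> i" "i < j"
  shows "card {A \<in> F. t \<le> min_inter F A} \<le> card {A \<in> shift i j F. t \<le> min_inter (shift i j F) A}"
proof (cases "F = {}")
  case False
  let ?G = "{A \<in> F. t \<le> min_inter F A}"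
  have fin: "finite F" "finite (shift i j F)" using finite_family[OF F] by (auto simp: shift_def)
  have ne: "shift i j F \<noteq> {}" using False by (simp add: shift_def)
  have "t \<le> card (X \<inter> Y)" if "X \<in> shift i j ?G" "Y \<in> shift i j F" for X Y
  proof (rule card_shift_set_Int[OF _ _ that])
    show "t \<le> card (A \<inter> B)" if "A \<in> ?G" "B \<in> F" for A B
      using that le_min_inter_iff[OF fin(1) False] by blast
    show "finite A" if "A \<in> ?G" for A using that F by (auto simp: nsets_def)
  qed
  moreover have "shift i j ?G \<subseteq> shift i j F" by (rule shift_mono) auto
  ultimately have "shift i j ?G \<subseteq> {A \<in> shift i j F. t \<le> min_inter (shift i j F) A}"
    using le_min_inter_iff[OF fin(2) ne] by auto
  then have "card (shift i j ?G) \<le> card {A \<in> shift i j F. t \<le> min_inter (shift i j F) A}"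
    using fin by (intro card_mono) auto
  then show ?thesis by (simp add: card_shift)
qed simp

section \<open>Stars and their recovery from a compression\<close>

lemma card_supersets:
  assumes "finite X" "C \<subseteq> X" "card C \<le> k"
  shows "card {A \<in> nsets X k. C \<subseteq> A} = (card X - card C) choose (k - card C)"
proof -
  have fC: "finite C" using assms finite_subset by blast
  have "bij_betw (\<lambda>A. A - C) {A \<in> nsets X k. C \<subseteq> A} (nsets (X - C) (k - card C))"
  proof (rule bij_betwI[where g = "\<lambda>T. T \<union> C"])
    show "(\<lambda>A. A - C) \<in> {A \<in> nsets X k. C \<subseteq> A} \<rightarrow> nsets (X - C) (k - card C)"
      using fC by (auto simp: nsets_def card_Diff_subset)
    show "(\<lambda>T. T \<union> C) \<in> nsets (X - C) (k - card C) \<rightarrow> {A \<in> nsets X k. C \<subseteq> A}"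
    proof
      fix T assume T: "T \<in> nsets (X - C) (k - card C)"
      then have "card (T \<union> C) = card T + card C" using fC by (intro card_Un_disjoint) (auto simp: nsets_def)
      then show "T \<union> C \<in> {A \<in> nsets X k. C \<subseteq> A}" using T assms fC by (auto simp: nsets_def)
    qed
  qed (auto simp: nsets_def)
  then have "card {A \<in> nsets X k. C \<subseteq> A} = card (nsets (X - C) (k - card C))" by (rule bij_betw_same_card)
  also have "\<dots> = card (X - C) choose (k - card C)" using assms(1) by (simp add: card_nsets)
  finally show ?thesis using assms fC by (simp add: card_Diff_subset)
qed

lemma obtain_disjoint_subset:
  assumes "finite R" "finite T" "card T + w \<le> card R"
  obtains U where "U \<subseteq> R" "U \<inter> T = {}" "card U = w" "finite U"
proof -
  have "card R - card T \<le> card (R - T)" using assms by (intro diff_card_le_card_Diff) auto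
  then have "w \<le> card (R - T)" using assms by linarith
  then obtain U where "U \<subseteq> R - T" "card U = w" "finite U" using obtain_subset_with_card_n by blast
  then show ?thesis using that by blast
qed

lemma min_inter_star:
  assumes "C \<subseteq> {1..n}" "card C = c" "c \<le> k" "2 * k \<le> n"
    and F: "F = {A \<in> nsets {1..n} k. C \<subseteq> A}" and A: "A \<in> F"
  shows "min_inter F A = c"
proof -
  have finF: "finite F" "F \<noteq> {}" using finite_family[of F n k] F A by auto
  have fin: "finite A" "finite C" "card A = k" "A \<subseteq> {1..n}" "C \<subseteq> A"
    using A F assms(1) by (auto simp: nsets_def intro: finite_subset)
  have "c \<le> card (A \<inter> B)" if "B \<in> F" for B
  proof -
    have "C \<subseteq> A \<inter> B" using that A F by auto
    then show ?thesis using fin assms(2) card_mono[of "A \<inter> B" C] by auto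
  qed
  then have ge: "c \<le> min_inter F A" using le_min_inter_iff[OF finF] by blast
  \<comment> \<open>As \<open>2 * k \<le> n\<close>, there is room for a member
    \<open>C \<union> U\<close> that meets \<open>A\<close> in the centre only.\<close>
  obtain U where U: "U \<subseteq> {1..n}" "U \<inter> A = {}" "card U = k - c" "finite U"
    by (rule obtain_disjoint_subset[of "{1..n}" A "k - c"]) (use fin assms in auto)
  have "card (C \<union> U) = card C + card U" using U fin by (intro card_Un_disjoint) auto
  then have "C \<union> U \<in> F" using F U fin assms by (auto simp: nsets_def)
  then have "min_inter F A \<le> card (A \<inter> (C \<union> U))" using le_min_inter_iff[OF finF, of "min_inter F A" A] by blast
  also have "A \<inter> (C \<union> U) = C" using U fin by auto
  finally show ?thesis using ge assms(2) by simp
qed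

lemma level_sum_star:
  assumes "is_star n k c F" "c \<le> k" "2 * k \<le> n"
  shows "level_sum n k F = 1"
proof -
  obtain C where C: "C \<subseteq> {1..n}" "card C = c" and F: "F = {A \<in> nsets {1..n} k. C \<subseteq> A}"
    using assms(1) by (auto simp: is_star_def)
  have "level_sum n k F = real (card F) * weight n k c"
    unfolding level_sum_def using min_inter_star[OF C assms(2,3) F] by simp
  moreover have "card F = (n - c) choose (k - c)"
    unfolding F using card_supersets[of "{1..n}" C k] C assms by simp
  moreover have "0 < (n - c) choose (k - c)" using assms by (simp add: zero_less_binomial_iff)
  ultimately show ?thesis by (simp add: weight_def)
qed

text \<open>If a set moves, the centre is \<open>D \<union> {i}\<close> with \<open>j \<notin> D\<close>, and \<open>F\<close> contains
  exactly one of \<open>D \<union> {i} \<union> T\<close> and \<open>D \<union> {j} \<union> T\<close> for each \<open>T\<close>. Disjoint \<open>T\<close> must make the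
  same choice, so all do, the Kneser graph being connected.\<close>

lemma is_star_of_shift:
  assumes F: "F \<subseteq> nsets {1..n} k" and n: "2 * k + 1 \<le> n" and ck: "c \<le> k"
    and star: "is_star n k c (shift i j F)"
    and int: "\<And>A B. A \<in> F \<Longrightarrow> B \<in> F \<Longrightarrow> c \<le> card (A \<inter> B)"
  shows "is_star n k c F"
proof (cases "shift i j F = F")
  case True
  then show ?thesis using star by simp
next
  case False
  obtain C where C: "C \<subseteq> {1..n}" "card C = c" and S: "shift i j F = {A \<in> nsets {1..n} k. C \<subseteq> A}"
    using star by (auto simp: is_star_def)
  have finC: "finite C" using C(1) finite_subset by blast
  have "\<exists>A\<in>F. shift_set i j F A \<noteq> A"
  proof (rule ccontr)
    assume "\<not> ?thesis"
    then have "shift_set i j F ` F = (\<lambda>A. A) ` F" by (intro image_cong) auto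
    then show False using False by (simp add: shift_def)
  qed
  then obtain A where A: "A \<in> F" "j \<in> A" "i \<notin> A" "insert i (A - {j}) \<notin> F"
    by (auto simp: shift_set_def split: if_splits)
  then have ij: "i \<noteq> j" by auto
  have unmoved: "B \<in> F" if "B \<in> shift i j F" "i \<notin> B \<or> j \<in> B" for B
    using that ij by (auto simp: shift_def shift_set_def split: if_splits)
  have in_S: "shift_set i j F B \<in> shift i j F" if "B \<in> F" for B using that by (auto simp: shift_def)
  have AS: "insert i (A - {j}) \<in> shift i j F" using in_S[OF A(1)] A by (simp add: shift_set_def)
  have "A \<notin> shift i j F"
  proof
    assume "A \<in> shift i j F"
    then obtain B where B: "B \<in> F" "A = shift_set i j F B" by (auto simp: shift_def)
    then have "A = B" using A by (auto simp: shift_set_def split: if_splits)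
    then show False using B A by (auto simp: shift_set_def split: if_splits)
  qed
  then have "\<not> C \<subseteq> A" using S A(1) F by auto
  moreover have CA: "C \<subseteq> insert i (A - {j})" using AS S by auto
  ultimately have iC: "i \<in> C" and jC: "j \<notin> C" using ij by auto
  define D where "D = C - {i}"
  have "finite D" "i \<notin> D" "j \<notin> D" using finC jC by (simp_all add: D_def)
  moreover have "insert i D = C" using iC by (simp add: D_def insert_absorb)
  moreover have "Suc (card D) = c" using card.remove[OF finC iC] C(2) by (simp add: D_def)
  moreover have "D \<subseteq> A" "D \<subseteq> {1..n}" using CA C(1) unfolding D_def by blast+
  ultimately have D: "finite D" "i \<notin> D" "j \<notin> D" "insert i D = C" "Suc (card D) = c" "D \<subseteq> A" "D \<subseteq> {1..n}"
    by blast+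
  define R where "R = {1..n} - insert j C"
  have "A \<in> nsets {1..n} k" using A(1) F by blast
  then have A_n: "A \<subseteq> {1..n}" "finite A" "card A = k" by (simp_all add: nsets_def)
  have jn: "j \<in> {1..n}" using A(2) A_n by blast
  have R: "finite R" "card R = n - Suc c" "i \<notin> R" "j \<notin> R" "R \<inter> D = {}"
  proof -
    show "card R = n - Suc c" using C finC jC jn unfolding R_def by (subst card_Diff_subset) auto
  qed (use iC D in \<open>auto simp: R_def\<close>)
  \<comment> \<open>The moved set \<open>A\<close> is \<open>D \<union> {j} \<union> T0\<close>, so
    \<open>T0\<close> is a first \<open>T\<close> with choice \<open>j\<close>.\<close>
  define T0 where "T0 = A - insert j D"
  have T0: "T0 \<subseteq> R" "finite T0" "card T0 = k - c"
  proof -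
    show "finite T0" using A_n by (simp add: T0_def)
    show "T0 \<subseteq> R" using A_n(1) A(3) D(4) unfolding T0_def R_def by blast
    have "card (insert j D) = c" using D by simp
    then show "card T0 = k - c" unfolding T0_def using D A A_n by (subst card_Diff_subset) auto
  qed
  have nsetI: "insert x (D \<union> T) \<in> nsets {1..n} k" if "T \<subseteq> R" "card T = k - c" "x \<in> {i, j}" for T x
  proof -
    have "finite T" using that R finite_subset by blast
    have "card (D \<union> T) = card D + card T" using D R that \<open>finite T\<close> by (intro card_Un_disjoint) auto
    moreover have "x \<notin> D \<union> T" using that D R by auto
    ultimately have "card (insert x (D \<union> T)) = k" using D that ck \<open>finite T\<close> by simp
    moreover have "x \<in> {1..n}" using that jn iC C by auto
    ultimately show ?thesis using D that \<open>finite T\<close> by (auto simp: nsets_def R_def)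
  qed
  have either: "insert i (D \<union> T) \<in> F \<or> insert j (D \<union> T) \<in> F"
    and not_both: "\<not> (insert i (D \<union> T) \<in> F \<and> insert j (D \<union> T) \<in> F)" if T: "T \<subseteq> R" "card T = k - c" for T
  proof -
    have Tij: "i \<notin> T" "j \<notin> T" using T R by auto
    have "insert i (D \<union> T) \<in> shift i j F" using nsetI[OF T, of i] S D by auto
    then obtain B where B: "B \<in> F" "insert i (D \<union> T) = shift_set i j F B" by (auto simp: shift_def)
    show "insert i (D \<union> T) \<in> F \<or> insert j (D \<union> T) \<in> F"
    proof (cases "shift_set i j F B = B")
      case False
      then have b: "j \<in> B" "i \<notin> B" "insert i (D \<union> T) = insert i (B - {j})"
        using B by (auto simp: shift_set_def split: if_splits)
      then have "D \<union> T = B - {j}" using D Tij by (metis Diff_iff Un_iff insert_ident)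
      then have "insert j (D \<union> T) = B" using b by auto
      then show ?thesis using B by simp
    qed (use B in simp)
    show "\<not> (insert i (D \<union> T) \<in> F \<and> insert j (D \<union> T) \<in> F)"
    proof
      assume both: "insert i (D \<union> T) \<in> F \<and> insert j (D \<union> T) \<in> F"
      have "insert j (D \<union> T) - {j} = D \<union> T" using D Tij by auto
      then have "shift_set i j F (insert j (D \<union> T)) = insert j (D \<union> T)" using both by (auto simp: shift_set_def)
      then have "insert j (D \<union> T) \<in> shift i j F" using both in_S by metis
      then have "C \<subseteq> insert j (D \<union> T)" using S by auto
      then show False using iC D Tij ij by auto
    qed
  qed
  \<comment> \<open>With different choices, the two members would meet in \<open>D\<close> alone,
    which has \<open>c - 1\<close> elements.\<close>
  have transfer: "insert j (D \<union> U) \<in> F"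
    if "insert j (D \<union> T) \<in> F" "T \<subseteq> R" "U \<subseteq> R" "card U = k - c" "T \<inter> U = {}" for T U
  proof (rule ccontr)
    assume "insert j (D \<union> U) \<notin> F"
    then have "insert i (D \<union> U) \<in> F" using either that by blast
    then have "c \<le> card (insert i (D \<union> U) \<inter> insert j (D \<union> T))" using int that by blast
    also have "insert i (D \<union> U) \<inter> insert j (D \<union> T) = D" using that R D ij by auto
    finally show False using D by simp
  qed
  \<comment> \<open>Exchanging one element gives \<open>T1\<close> closer to \<open>T0\<close>; a
    set \<open>U\<close> disjoint from both \<open>T1\<close> and \<open>T\<close> then carries the
    choice from \<open>T1\<close> to \<open>T\<close>. Room for \<open>U\<close> comes from
    \<open>2 * k + 1 \<le> n\<close> and \<open>1 \<le> c\<close>.\<close>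
  have all_T: "insert j (D \<union> T) \<in> F" if "T \<subseteq> R" "card T = k - c" for T
    using that
  proof (induction "card (T - T0)" arbitrary: T rule: less_induct)
    case less
    have finT: "finite T" using less.prems R finite_subset by blast
    show ?case
    proof (cases "T \<subseteq> T0")
      case True
      then have "T = T0" using T0 less.prems by (simp add: card_subset_eq)
      then have "insert j (D \<union> T) = A" using A D by (auto simp: T0_def)
      then show ?thesis using A by simp
    next
      case False
      then obtain b where b: "b \<in> T" "b \<notin> T0" by auto
      have "\<not> T0 \<subseteq> T" using False T0 less.prems finT by (metis card_subset_eq order_refl)
      then obtain a where a: "a \<in> T0" "a \<notin> T" by auto
      define T1 where "T1 = insert a (T - {b})"
      have T1: "T1 \<subseteq> R" "card T1 = k - c" "finite T1"
        using a b less.prems T0 finT card_swap[of T b a] by (auto simp: T1_def)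
      have "T1 - T0 = (T - T0) - {b}" using a by (auto simp: T1_def)
      then have "card (T1 - T0) < card (T - T0)" using b finT by (metis DiffI card_Diff1_less finite_Diff)
      then have 1: "insert j (D \<union> T1) \<in> F" using less.hyps T1 by blast
      have "card (insert a T) = Suc (k - c)" using a finT less.prems by simp
      moreover have "Suc (k - c) + (k - c) \<le> card R" using R n D(5) ck by linarith
      ultimately obtain U where U: "U \<subseteq> R" "U \<inter> insert a T = {}" "card U = k - c" "finite U"
        using obtain_disjoint_subset[of R "insert a T" "k - c"] R finT by auto
      have 2: "insert j (D \<union> U) \<in> F" by (rule transfer[OF 1 T1(1) U(1,3)]) (use U in \<open>auto simp: T1_def\<close>)
      show ?thesis by (rule transfer[OF 2 U(1) less.prems]) (use U in auto)
    qed
  qed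
  have "F = {B \<in> nsets {1..n} k. insert j D \<subseteq> B}"
  proof (intro set_eqI iffI)
    fix B assume B: "B \<in> F"
    then have Bn: "B \<in> nsets {1..n} k" using F by auto
    have "insert j D \<subseteq> B"
    proof (cases "shift_set i j F B = B")
      case False
      then have b: "j \<in> B" "i \<notin> B" "shift_set i j F B = insert i (B - {j})"
        using B by (auto simp: shift_set_def split: if_splits)
      then have "C \<subseteq> insert i (B - {j})" using in_S[OF B] S by simp
      then show ?thesis using b D by auto
    next
      case True
      then have CB: "C \<subseteq> B" using in_S[OF B] S by simp
      have "j \<in> B"
      proof (rule ccontr)
        assume "j \<notin> B"
        have "B - C \<subseteq> R" using Bn \<open>j \<notin> B\<close> by (auto simp: R_def nsets_def)
        moreover have "card (B - C) = k - c" using Bn CB C finC by (auto simp: nsets_def card_Diff_subset)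
        moreover have "insert i (D \<union> (B - C)) = B" using CB D by auto
        ultimately show False using all_T[of "B - C"] not_both[of "B - C"] B by simp
      qed
      then show ?thesis using CB D by auto
    qed
    then show "B \<in> {B \<in> nsets {1..n} k. insert j D \<subseteq> B}" using Bn by simp
  next
    fix B assume "B \<in> {B \<in> nsets {1..n} k. insert j D \<subseteq> B}"
    then have B: "B \<in> nsets {1..n} k" "insert j D \<subseteq> B" by auto
    show "B \<in> F"
    proof (cases "i \<in> B")
      case True
      then have "B \<in> shift i j F" using S B D by auto
      then show ?thesis using unmoved B by blast
    next
      case False
      let ?T = "B - insert j D"
      have "?T \<subseteq> R" using B False D by (auto simp: R_def nsets_def)
      moreover have "card ?T = k - c" using B D by (auto simp: nsets_def card_Diff_subset)
      moreover have "insert j (D \<union> ?T) = B" using B by auto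
      ultimately show ?thesis using all_T[of ?T] by simp
    qed
  qed
  moreover have "card (insert j D) = c" using D by simp
  moreover have "insert j D \<subseteq> {1..n}" using D jn by auto
  ultimately show ?thesis unfolding is_star_def by blast
qed

context large_ground_set
begin

lemma level_sum_le_shift:
  assumes "F \<subseteq> nsets {1..n} k" "1 \<le> i" "i < j"
  shows "level_sum n k F \<le> level_sum n k (shift i j F)"
  unfolding level_sum_layers[OF assms(1)] level_sum_layers[OF shift_subset_nsets[OF assms]] card_shift
proof (intro add_left_mono sum_mono mult_left_mono)
  fix t assume "t \<in> {1..k}"
  then show "0 \<le> weight n k t - weight n k (t - 1)" using weight_mono[of "t - 1" t] by simp
qed (use card_level_shift[OF assms] in simp)

text \<open>The compressed star has no member above level \<open>c\<close>, so by
  \<open>card_level_shift\<close> neither has \<open>F\<close>. As \<open>F\<close> is as large as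
  the star, sum 1 forces every level to be exactly \<open>c\<close>, which is the intersection
  property that \<open>is_star_of_shift\<close> asks for.\<close>

lemma star_of_shift_equality:
  assumes F: "F \<subseteq> nsets {1..n} k" and ij: "1 \<le> i" "i < j"
    and c: "c \<le> k" "is_star n k c (shift i j F)" and eq: "level_sum n k F = 1"
  shows "is_star n k c F"
proof (rule is_star_of_shift[OF F n_ge c])
  obtain C where C: "C \<subseteq> {1..n}" "card C = c" and S: "shift i j F = {A \<in> nsets {1..n} k. C \<subseteq> A}"
    using c by (auto simp: is_star_def)
  have finF: "finite F" using finite_family[OF F] .
  have le: "min_inter F A \<le> c" if "A \<in> F" for A
  proof (rule ccontr)
    assume "\<not> min_inter F A \<le> c"
    then have "0 < card {A \<in> F. Suc c \<le> min_inter F A}" using finF that by (auto simp: card_gt_0_iff)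
    then have "0 < card {A \<in> shift i j F. Suc c \<le> min_inter (shift i j F) A}"
      using card_level_shift[OF F ij, of "Suc c"] by linarith
    then obtain A where "A \<in> shift i j F" "Suc c \<le> min_inter (shift i j F) A" by (auto simp: card_gt_0_iff)
    then show False using min_inter_star[OF C c(1) _ S] n_ge by simp
  qed
  have "card F = (n - c) choose (k - c)"
    using card_supersets[of "{1..n}" C k] C c S card_shift[of i j F] by simp
  moreover have "0 < (n - c) choose (k - c)" using c n_ge by (simp add: zero_less_binomial_iff)
  ultimately have total: "(\<Sum>A\<in>F. weight n k c) = 1" by (simp add: weight_def)
  have eq_c: "min_inter F A = c" if "A \<in> F" for A
  proof (rule ccontr)
    assume "min_inter F A \<noteq> c"
    then have "weight n k (min_inter F A) < weight n k c"
      using le[OF that] c by (intro weight_strict_mono) auto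
    then have "level_sum n k F < (\<Sum>A\<in>F. weight n k c)"
      unfolding level_sum_def using le c finF that by (intro sum_strict_mono_ex1 ballI weight_mono) auto
    then show False using total eq by simp
  qed
  show "c \<le> card (A \<inter> B)" if "A \<in> F" "B \<in> F" for A B
    using le_min_inter_iff[OF finF, of c A] eq_c that by blast
qed

lemma reduction_to_shifted:
  assumes shifted: "\<And>F. F \<subseteq> nsets {1..n} k \<Longrightarrow> left_shifted F \<Longrightarrow>
      level_sum n k F \<le> 1 \<and> (level_sum n k F = 1 \<longrightarrow> (\<exists>c\<le>k. is_star n k c F))"
    and F: "F \<subseteq> nsets {1..n} k"
  shows "level_sum n k F \<le> 1 \<and> (level_sum n k F = 1 \<longrightarrow> (\<exists>c\<le>k. is_star n k c F))"
  using F
proof (induction "\<Sum>X\<in>F. \<Sum>X" arbitrary: F rule: less_induct)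
  case less
  show ?case
  proof (cases "left_shifted F")
    case True
    then show ?thesis using shifted less.prems by blast
  next
    case False
    then obtain A i j where A: "A \<in> F" "1 \<le> i" "i < j" "j \<in> A" "i \<notin> A" "insert i (A - {j}) \<notin> F"
      by (auto simp: left_shifted_def)
    have "(\<Sum>X\<in>shift i j F. \<Sum>X) < (\<Sum>X\<in>F. \<Sum>X)"
      using finite_family[OF less.prems] less.prems A by (intro sum_shift_less[of _ i j A]) (auto simp: nsets_def)
    then have IH: "level_sum n k (shift i j F) \<le> 1"
      "level_sum n k (shift i j F) = 1 \<Longrightarrow> \<exists>c\<le>k. is_star n k c (shift i j F)"
      using less.hyps[of "shift i j F"] shift_subset_nsets[OF less.prems A(2,3)] by auto
    have le: "level_sum n k F \<le> level_sum n k (shift i j F)" by (rule level_sum_le_shift[OF less.prems A(2,3)])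
    show ?thesis
    proof (intro conjI impI)
      show "level_sum n k F \<le> 1" using le IH by linarith
      assume eq: "level_sum n k F = 1"
      \<comment> \<open>The compressed sum lies between 1 and 1, so equality passes to the
        compressed family.\<close>
      then obtain c where "c \<le> k" "is_star n k c (shift i j F)" using IH le by force
      then show "\<exists>c\<le>k. is_star n k c F" using star_of_shift_equality[OF less.prems A(2,3) _ _ eq] by blast
    qed
  qed
qed

end

subsection \<open>Left-shifted families\<close>

lemma interval_conv: "{1..n} = {0<..n::nat}"
  by auto

lemma card_prefix_eq:
  assumes "p \<le> n" "q \<le> k"
  shows "card {A \<in> nsets {1..n} k. card (A \<inter> {..p}) = q} \<le> (p choose q) * ((n - p) choose (k - q))"
proof -
  let ?S = "{A \<in> nsets {1..n} k. card (A \<inter> {..p}) = q}"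
  let ?f = "\<lambda>A. (A \<inter> {..p}, A \<inter> {p<..})"
  have "inj_on ?f ?S"
  proof (rule inj_onI)
    fix A B assume "?f A = ?f B"
    then have "(A \<inter> {..p}) \<union> (A \<inter> {p<..}) = (B \<inter> {..p}) \<union> (B \<inter> {p<..})" by simp
    moreover have "(X \<inter> {..p}) \<union> (X \<inter> {p<..}) = X" for X by auto
    ultimately show "A = B" by simp
  qed
  moreover have "?f ` ?S \<subseteq> nsets {1..p} q \<times> nsets {p<..n} (k - q)"
  proof
    fix y assume "y \<in> ?f ` ?S"
    then obtain A where A: "A \<in> ?S" and y: "y = ?f A" by auto
    have An: "A \<subseteq> {1..n}" "finite A" "card A = k" "card (A \<inter> {..p}) = q" using A by (auto simp: nsets_def)
    have "A = (A \<inter> {..p}) \<union> (A \<inter> {p<..})" by auto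
    then have "card A = card (A \<inter> {..p}) + card (A \<inter> {p<..})"
      using An card_Un_disjoint[of "A \<inter> {..p}" "A \<inter> {p<..}"] by fastforce
    then have "card (A \<inter> {p<..}) = k - q" using An by simp
    then show "y \<in> nsets {1..p} q \<times> nsets {p<..n} (k - q)"
      using An unfolding y nsets_def by auto
  qed
  ultimately have "card ?S \<le> card (nsets {1..p} q \<times> nsets {p<..n} (k - q))"
    by (rule card_inj_on_le) (simp del: One_nat_def)
  then show ?thesis by (simp add: card_nsets card_cartesian_product)
qed

lemma sum_powers_le:
  fixes x :: real
  assumes "0 \<le> x" "x < 1"
  shows "(\<Sum>d=1..N. x ^ d) \<le> x / (1 - x)"
proof -
  have "(1 - x) * (\<Sum>d=1..N. x ^ d) = x - x ^ Suc N"
  proof (induction N)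
    case (Suc N)
    have "(1 - x) * (\<Sum>d=1..Suc N. x ^ d) = (1 - x) * (\<Sum>d=1..N. x ^ d) + (1 - x) * x ^ Suc N"
      by (simp add: distrib_left)
    then show ?case unfolding Suc.IH by (simp add: left_diff_distrib)
  qed simp
  also have "\<dots> \<le> x" using assms by simp
  finally show ?thesis using assms by (simp add: field_simps)
qed

locale shifted_family = large_ground_set +
  fixes F :: "nat set set"
  assumes F: "F \<subseteq> nsets {1..n} k" and shifted: "left_shifted F"
begin

lemma finF: "finite F"
  by (rule finite_family[OF F])

lemma F_nsets: "F \<subseteq> nsets {0<..n} k"
  using F by (simp only: interval_conv)

lemma card_F_reaches:
  assumes "v \<le> k"
  shows "card {A \<in> F. reaches 0 v A} \<le> n choose (k - v)"
proof -
  have "card {A \<in> F. reaches 0 v A} \<le> card {A \<in> nsets {0<..0 + n} (v + (k - v)). reaches 0 v A}"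
    using F_nsets assms by (intro card_mono) auto
  also have "\<dots> \<le> n choose (k - v)" by (rule card_reaches)
  finally show ?thesis .
qed

lemma F_reaches_le: "v \<le> k" if "A \<in> F" "reaches 0 v A"
  using that F_nsets reaches_le[of A 0 n k v] by blast

text \<open>Members that rise above height \<open>u\<close> are an error term, even if all of them
  are counted with the weight of level \<open>u\<close>.\<close>

lemma weight_reaches_Suc:
  assumes "u \<le> k"
  shows "weight n k u * real (card {A \<in> F. reaches 0 (Suc u) A}) \<le> 3 * (real (k - u) / m)"
proof (cases "u = k")
  case True
  then have "{A \<in> F. reaches 0 (Suc u) A} = {}" using F_reaches_le[of _ "Suc u"] by auto
  then show ?thesis by (simp only: card.empty) simp
next
  case False
  then have "card {A \<in> F. reaches 0 (Suc u) A} \<le> n choose (k - u - 1)"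
    using card_F_reaches[of "Suc u"] assms by simp
  then have "weight n k u * real (card {A \<in> F. reaches 0 (Suc u) A}) \<le> weight n k u * real (n choose (k - u - 1))"
    using weight_pos[OF assms] by (intro mult_left_mono) auto
  also have "\<dots> \<le> 3 * (real (k - u) / m) ^ 1"
    using False assms by (intro weight_reaches_estimate) auto
  finally show ?thesis by simp
qed

lemma exists_critical_height:
  assumes "F \<noteq> {}"
  obtains u B where "\<forall>A\<in>F. reaches 0 u A" "B \<in> F" "\<not> reaches 0 (Suc u) B"
proof -
  have "\<exists>u. (\<forall>A\<in>F. reaches 0 u A) \<and> \<not> (\<forall>A\<in>F. reaches 0 (Suc u) A)"
  proof (rule ccontr)
    assume neg: "\<not> ?thesis"
    have "\<forall>A\<in>F. reaches 0 u A" for u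
    proof (induction u)
      case 0
      show ?case by (auto simp: reaches_def)
    next
      case (Suc u)
      then show ?case using neg by blast
    qed
    then show False using F_reaches_le[of _ "Suc k"] assms by fastforce
  qed
  then show ?thesis using that by blast
qed

end

section \<open>Levels above, at and below the critical height\<close>

locale critical_family = shifted_family +
  fixes u :: nat and B0 :: "nat set"
  assumes reach: "A \<in> F \<Longrightarrow> reaches 0 u A" and B0: "B0 \<in> F" "\<not> reaches 0 (Suc u) B0"
begin

abbreviation "upper \<equiv> {A \<in> F. u \<le> min_inter F A}"
abbreviation "\<delta> \<equiv> real (k - u) / m"

lemma neF: "F \<noteq> {}" using B0 by auto

lemma u_le: "u \<le> k"
  using F_reaches_le reach B0(1) by blast

lemma le_level_iff: "t \<le> min_inter F A \<longleftrightarrow> (\<forall>B\<in>F. t \<le> card (A \<inter> B))"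
  by (rule le_min_inter_iff[OF finF neF])

lemma prefix_sum:
  assumes "A \<in> F" "t \<le> min_inter F A" "B \<in> F"
  shows "\<exists>p. p + t \<le> card (A \<inter> {..p}) + card (B \<inter> {..p})"
  using left_shifted_prefix_sum[OF shifted _ assms(1) _ assms(3)] F assms(2)
  by (simp only: interval_conv le_level_iff)

text \<open>Compare with \<open>B0\<close>, which stays at height at most \<open>u\<close>: at the
  time \<open>p\<close> given by \<open>prefix_sum\<close> it has at most \<open>(p + u) / 2\<close>
  elements, so \<open>A\<close> has at least \<open>p + t - (p + u) / 2\<close>. For
  \<open>2 * t < u\<close> the truncated target is 0.\<close>

lemma level_reaches:
  assumes "A \<in> F" "t \<le> min_inter F A"
  shows "reaches 0 (2 * t - u) A"
proof -
  obtain p where p: "p + t \<le> card (A \<inter> {..p}) + card (B0 \<inter> {..p})" using prefix_sum[OF assms B0(1)] by blast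
  have "\<not> Suc u + p \<le> 2 * card (B0 \<inter> {..p}) + 0" using B0(2) unfolding reaches_def by blast
  then have "2 * t - u + p \<le> 2 * card (A \<inter> {..p}) + 0 \<or> 2 * t < u" using p by linarith
  then show ?thesis
  proof
    assume "2 * t - u + p \<le> 2 * card (A \<inter> {..p}) + 0"
    then show ?thesis unfolding reaches_def by blast
  next
    assume "2 * t < u"
    then show ?thesis unfolding reaches_def by (intro exI[of _ 0]) simp
  qed
qed

lemma \<delta>_small: "0 \<le> \<delta>" "\<delta> \<le> 1 / 1000" "(real (k - u) + 1)  / m \<le> 1 / 1000" "\<delta> < 1"
proof -
  show "0 \<le> \<delta>" by simp
  have "(real (k - u) + 1) / m \<le> (real k + 1) / m" using m_pos by (intro divide_right_mono) auto
  then show 1: "(real (k - u) + 1) / m \<le> 1 / 1000" using k_over_m by (rule order_trans)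
  have "\<delta> \<le> (real (k - u) + 1) / m" using m_pos by (intro divide_right_mono) auto
  then show "\<delta> \<le> 1 / 1000" using 1 by (rule order_trans)
  then show "\<delta> < 1" by (rule le_less_trans) simp
qed

text \<open>Level \<open>t\<close> reaches height \<open>2 * t - u\<close>, which is
  \<open>t - u\<close> more than \<open>t\<close>, so \<open>weight_reaches_estimate\<close> bounds
  its share by \<open>3 * \<delta> ^ (t - u)\<close>; the shares are summed as a geometric
  series.\<close>

lemma high_level_sum:
  "(\<Sum>A\<in>{A \<in> F. u < min_inter F A}. weight n k (min_inter F A)) \<le> 3 * \<delta> / (1 - \<delta>)"
proof -
  let ?H = "{A \<in> F. u < min_inter F A}"
  have level: "(\<Sum>A\<in>{A \<in> ?H. min_inter F A = t}. weight n k (min_inter F A)) \<le> 3 * \<delta> ^ (t - u)"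
    if t: "t \<in> {u<..k}" for t
  proof -
    let ?L = "{A \<in> ?H. min_inter F A = t}"
    have sub: "?L \<subseteq> {A \<in> F. reaches 0 (2 * t - u) A}" using level_reaches by auto
    have "(\<Sum>A\<in>?L. weight n k (min_inter F A)) = weight n k t * real (card ?L)" by simp
    also have "\<dots> \<le> 3 * \<delta> ^ (t - u)"
    proof (cases "2 * t - u \<le> k")
      case True
      have "card ?L \<le> card {A \<in> F. reaches 0 (2 * t - u) A}" using sub finF by (intro card_mono) auto
      also have "\<dots> \<le> n choose (k - (2 * t - u))" by (rule card_F_reaches[OF True])
      also have "k - (2 * t - u) = k - t - (t - u)" using t by auto
      finally have "weight n k t * real (card ?L) \<le> weight n k t * real (n choose (k - t - (t - u)))"
        using weight_pos[of t] t by (intro mult_left_mono) auto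
      also have "\<dots> \<le> 3 * (real (k - t) / m) ^ (t - u)"
        using True t by (intro weight_reaches_estimate) auto
      also have "\<dots> \<le> 3 * \<delta> ^ (t - u)"
        using t m_pos by (intro mult_left_mono power_mono divide_right_mono) auto
      finally show ?thesis .
    next
      case False
      then have "?L = {}" using sub F_reaches_le by blast
      then have "card ?L = 0" by (simp only: card.empty)
      then show ?thesis using \<delta>_small(1) by simp
    qed
    finally show ?thesis .
  qed
  have "(\<Sum>A\<in>?H. weight n k (min_inter F A))
      = (\<Sum>t\<in>{u<..k}. \<Sum>A\<in>{A \<in> ?H. min_inter F A = t}. weight n k (min_inter F A))"
    using finF min_inter_le_card[OF F] by (intro sum.group[symmetric]) auto
  also have "\<dots> \<le> (\<Sum>t\<in>{u<..k}. 3 * \<delta> ^ (t - u))" by (intro sum_mono level)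
  also have "\<dots> = 3 * (\<Sum>t\<in>{u<..k}. \<delta> ^ (t - u))" by (simp only: sum_distrib_left)
  also have "(\<Sum>t\<in>{u<..k}. \<delta> ^ (t - u)) = (\<Sum>d\<in>{1..k - u}. \<delta> ^ d)"
    by (rule sum.reindex_bij_witness[of _ "\<lambda>d. d + u" "\<lambda>t. t - u"]) auto
  also have "3 * (\<Sum>d\<in>{1..k - u}. \<delta> ^ d) \<le> 3 * (\<delta> / (1 - \<delta>))"
    using \<delta>_small by (intro mult_left_mono sum_powers_le) auto
  finally show ?thesis by simp
qed

text \<open>The three terms stand for level \<open>u\<close>, the levels below it, each weighted by
  at most \<open>weight n k (u - 1)\<close>, and the levels above it.\<close>

lemma level_sum_bound:
  "level_sum n k F \<le> weight n k u * real (card upper)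
     + weight n k u * real (card F) * ((real (k - u) + 1) / m) + 3 * \<delta> / (1 - \<delta>)"
proof -
  let ?w = "\<lambda>A. weight n k (min_inter F A)"
  let ?L = "{A \<in> F. min_inter F A < u}" and ?E = "{A \<in> F. min_inter F A = u}" and ?H = "{A \<in> F. u < min_inter F A}"
  have "level_sum n k F = sum ?w (?L \<union> (?E \<union> ?H))"
    unfolding level_sum_def by (intro sum.cong) auto
  also have "\<dots> = sum ?w ?L + (sum ?w ?E + sum ?w ?H)"
    using finF by (subst sum.union_disjoint; (subst sum.union_disjoint)?) auto
  finally have split: "level_sum n k F = sum ?w ?L + (sum ?w ?E + sum ?w ?H)" .
  have wpos: "0 < weight n k u" by (rule weight_pos[OF u_le])
  have "sum ?w ?L \<le> (\<Sum>A\<in>?L. weight n k u * ((real (k - u) + 1) / m))"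
  proof (rule sum_mono)
    fix A assume "A \<in> ?L"
    then have "1 \<le> u" "min_inter F A \<le> u - 1" by auto
    then have "?w A \<le> weight n k (u - 1)" using u_le by (intro weight_mono) auto
    also have "\<dots> \<le> weight n k u * ((real (k - u) + 1) / m)" using \<open>1 \<le> u\<close> u_le by (rule weight_pred)
    finally show "?w A \<le> weight n k u * ((real (k - u) + 1) / m)" .
  qed
  also have "\<dots> = real (card ?L) * (weight n k u * ((real (k - u) + 1) / m))" by simp
  also have "\<dots> \<le> real (card F) * (weight n k u * ((real (k - u) + 1) / m))"
    using finF wpos m_pos by (intro mult_right_mono) (auto intro!: card_mono)
  finally have low: "sum ?w ?L \<le> weight n k u * real (card F) * ((real (k - u) + 1) / m)" by (simp add: mult_ac)
  have "sum ?w ?E = weight n k u * real (card ?E)" by simp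
  also have "\<dots> \<le> weight n k u * real (card upper)"
    using finF wpos by (intro mult_left_mono) (auto intro!: card_mono)
  finally show ?thesis using split low high_level_sum by linarith
qed

lemma weight_card_F: "weight n k u * real (card F) \<le> 3"
proof -
  have "card F \<le> card {A \<in> F. reaches 0 u A}" using reach finF by (intro card_mono) auto
  also have "\<dots> \<le> n choose (k - u - 0)" using card_F_reaches[OF u_le] by simp
  finally have "weight n k u * real (card F) \<le> weight n k u * real (n choose (k - u - 0))"
    using weight_pos[OF u_le] by (intro mult_left_mono) auto
  also have "\<dots> \<le> 3 * \<delta> ^ 0" by (rule weight_reaches_estimate[OF u_le]) simp
  finally show ?thesis by simp
qed

text \<open>The margin 1/81 exceeds the three error terms, each at most about 3/1000.\<close>

lemma level_sum_less_1:
  assumes "weight n k u * real (card upper) \<le> 80 / 81 + 3 * \<delta>"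
  shows "level_sum n k F < 1"
proof -
  have "weight n k u * real (card F) * ((real (k - u) + 1) / m) \<le> 3 * (1 / 1000)"
    using weight_card_F \<delta>_small m_pos by (intro mult_mono) auto
  moreover have "3 * \<delta> / (1 - \<delta>) \<le> 3 * (1 / 1000) / (1 - 1 / 1000)"
    using \<delta>_small by (intro frac_le) auto
  ultimately show ?thesis using level_sum_bound assms \<delta>_small(2) by simp
qed

section \<open>Level \<open>u\<close> and the visits to height \<open>u\<close>\<close>

lemma all_revisit:
  assumes "\<forall>A\<in>upper. revisits 0 u A"
  shows "level_sum n k F < 1"
proof (rule level_sum_less_1)
  have wpos: "0 < weight n k u" by (rule weight_pos[OF u_le])
  have sub: "upper \<subseteq> {A \<in> nsets {0<..0 + n} k. revisits 0 u A}" using assms F_nsets by auto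
  show "weight n k u * real (card upper) \<le> 80 / 81 + 3 * \<delta>"
  proof (cases "u = k")
    case True
    then have "upper = {}" using sub revisits_lt[of _ 0 "0 + n" k u] by blast
    then have "card upper = 0" by (simp only: card.empty)
    then show ?thesis using \<delta>_small by simp
  next
    case False
    then have k: "u + Suc (k - u - 1) = k" using u_le by simp
    have "card upper \<le> card {A \<in> nsets {0<..0 + n} (u + Suc (k - u - 1)). revisits 0 u A}"
      unfolding k by (intro card_mono sub) simp
    also have "\<dots> \<le> 2 * (n choose (k - u - 1))" by (rule card_revisits)
    finally have "weight n k u * real (card upper) \<le> weight n k u * real (2 * (n choose (k - u - 1)))"
      using wpos by (intro mult_left_mono) (simp_all only: of_nat_le_iff less_imp_le)
    also have "\<dots> = 2 * (weight n k u * real (n choose (k - u - 1)))" by simp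
    also have "\<dots> \<le> 2 * (3 * \<delta> ^ 1)"
      using False u_le by (intro mult_left_mono weight_reaches_estimate) auto
    finally show ?thesis using \<delta>_small by simp
  qed
qed

text \<open>A walk of level \<open>u\<close> that visits height \<open>u\<close> only once pins every other walk of the family that
  stays at height at most \<open>u\<close> to the same visit.\<close>

lemma common_visit:
  assumes A0: "A0 \<in> upper" "\<not> revisits 0 u A0"
  obtains r where "u + r \<le> k"
    "\<And>B. B \<in> F \<Longrightarrow> reaches 0 (Suc u) B \<or> card (B \<inter> {..u + 2 * r}) = u + r"
proof -
  have A0n: "A0 \<in> nsets {0<..n} k" using A0 F_nsets by blast
  define q where "q p = card (A0 \<inter> {..p})" for p
  obtain p where p: "u + p \<le> 2 * q p" using reach[of A0] A0 by (auto simp: reaches_def q_def)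
  have uniq: "2 * q p' < u + p'" if "p' \<noteq> p" for p'
  proof (rule ccontr)
    assume "\<not> 2 * q p' < u + p'"
    then have "u + p' \<le> 2 * q p' + 0" "u + p \<le> 2 * q p + 0" using p by auto
    then show False using A0(2) that unfolding revisits_def q_def by (metis linorder_neqE_nat le0)
  qed
  \<comment> \<open>Heights change by one per step, so a height above \<open>u\<close> at time
    \<open>p\<close> would give height at least \<open>u\<close> one step earlier, a second
    visit.\<close>
  have eq: "2 * q p = u + p"
  proof (rule ccontr)
    assume "2 * q p \<noteq> u + p"
    then have gt: "u + p < 2 * q p" using p by simp
    then obtain p' where p': "p = Suc p'" using card_prefix_le(2)[OF A0n, of 0] by (cases p) (auto simp: q_def)
    have "A0 \<inter> {..p} \<subseteq> insert p (A0 \<inter> {..p'})" by (auto simp: p' le_Suc_eq)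
    then have "q p \<le> card (insert p (A0 \<inter> {..p'}))" unfolding q_def by (intro card_mono) auto
    also have "\<dots> \<le> Suc (q p')" unfolding q_def by (rule card_insert_le_m1) auto
    finally show False using uniq[of p'] gt p' by simp
  qed
  have qle: "q p \<le> k" "q p \<le> p" using card_prefix_le[OF A0n, of p] by (auto simp: q_def)
  \<comment> \<open>\<open>r\<close> is the number of down-steps before the visit.\<close>
  define r where "r = q p - u"
  have r: "q p = u + r" "p = u + 2 * r" using eq qle by (auto simp: r_def)
  show ?thesis
  proof (rule that[of r])
    show "u + r \<le> k" using r qle by simp
    fix B assume B: "B \<in> F"
    then obtain p' where p': "p' + u \<le> q p' + card (B \<inter> {..p'})"
      using prefix_sum[of A0 u B] A0 by (auto simp: q_def)
    show "reaches 0 (Suc u) B \<or> card (B \<inter> {..u + 2 * r}) = u + r"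
    proof (cases "p' = p \<and> card (B \<inter> {..p}) = u + r")
      case False
      \<comment> \<open>At any time other than \<open>p\<close> the walk of \<open>A0\<close> is
        below \<open>u\<close>, so \<open>B\<close> must be above \<open>u\<close> there; at time
        \<open>p\<close> itself, \<open>B\<close> has more than \<open>u + r\<close>
        elements.\<close>
      have "Suc u + p' \<le> 2 * card (B \<inter> {..p'}) + 0"
      proof (cases "p' = p")
        case True
        then show ?thesis using False p' r by simp
      next
        case False
        then show ?thesis using uniq[of p'] p' by simp
      qed
      then show ?thesis unfolding reaches_def by blast
    qed (use r in simp)
  qed
qed

lemma weight_card_le:
  assumes "X \<subseteq> {A \<in> F. reaches 0 (Suc u) A} \<union> Y" "finite Y" "card Y \<le> N"
  shows "weight n k u * real (card X) \<le> weight n k u * real N + 3 * \<delta>"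
proof -
  have "card X \<le> card ({A \<in> F. reaches 0 (Suc u) A} \<union> Y)" using assms finF by (intro card_mono) auto
  also have "\<dots> \<le> card {A \<in> F. reaches 0 (Suc u) A} + card Y" by (rule card_Un_le)
  finally have "real (card X) \<le> real N + real (card {A \<in> F. reaches 0 (Suc u) A})" using assms(3) by linarith
  then have "weight n k u * real (card X) \<le> weight n k u * (real N + real (card {A \<in> F. reaches 0 (Suc u) A}))"
    using weight_pos[OF u_le] by (intro mult_left_mono) auto
  also have "\<dots> \<le> weight n k u * real N + 3 * \<delta>"
    using weight_reaches_Suc[OF u_le] by (simp add: distrib_left)
  finally show ?thesis .
qed

text \<open>Apart from members rising above \<open>u\<close>, the sets in \<open>upper\<close>
  contain \<open>{1..u}\<close> and meet \<open>B\<close> outside it. By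
  \<open>avoiding_estimate\<close> this excludes at least the proportion 1/81 of the star.\<close>

lemma visit_at_start:
  assumes visit: "\<And>B. B \<in> F \<Longrightarrow> reaches 0 (Suc u) B \<or> {1..u} \<subseteq> B"
    and B: "B \<in> nsets {1..n} k" and meet: "\<And>A. A \<in> upper \<Longrightarrow> {1..u} \<subseteq> A \<Longrightarrow> \<not> A \<inter> B \<subseteq> {1..u}"
  shows "level_sum n k F < 1"
proof (rule level_sum_less_1)
  let ?C = "{1..u}"
  let ?X = "{A \<in> nsets {1..n} k. ?C \<subseteq> A}" and ?Z = "{A \<in> nsets ({1..n} - (B - ?C)) k. ?C \<subseteq> A}"
  have Bn: "finite B" "card B = k" "B \<subseteq> {1..n}" using B by (simp_all add: nsets_def)
  have un: "u \<le> n" using u_le n_ge by simp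
  have finX: "finite ?X" using finite_imp_finite_nsets[of "{1..n}" k] by auto
  have ZX: "?Z \<subseteq> ?X" by (auto simp: nsets_def)
  have "card ?X = (n - u) choose (k - u)"
    using card_supersets[of "{1..n}" ?C k] u_le un by auto
  moreover have "card ?Z \<ge> (n - u - k) choose (k - u)"
  proof -
    have "card ?Z = (card ({1..n} - (B - ?C)) - card ?C) choose (k - card ?C)"
      using u_le un by (intro card_supersets) auto
    moreover have "card ({1..n} - (B - ?C)) = n - card (B - ?C)"
      using Bn by (subst card_Diff_subset) auto
    moreover have "card (B - ?C) \<le> k" using Bn by (metis card_Diff_subset_Int card_mono Diff_subset)
    ultimately show ?thesis by (simp add: binomial_right_mono)
  qed
  ultimately have card: "card (?X - ?Z) \<le> ((n - u) choose (k - u)) - ((n - u - k) choose (k - u))"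
    using card_Diff_subset[OF finite_subset[OF ZX finX] ZX] by (simp only: diff_le_mono2)
  have "upper \<subseteq> {A \<in> F. reaches 0 (Suc u) A} \<union> (?X - ?Z)"
  proof
    fix A assume A: "A \<in> upper"
    show "A \<in> {A \<in> F. reaches 0 (Suc u) A} \<union> (?X - ?Z)"
    proof (cases "reaches 0 (Suc u) A")
      case False
      then have C: "?C \<subseteq> A" using visit A by blast
      have "A \<notin> ?Z" using meet[OF A C] by (auto simp: nsets_def)
      then show ?thesis using A C F by blast
    qed (use A in blast)
  qed
  then have "weight n k u * real (card upper)
      \<le> weight n k u * real (((n - u) choose (k - u)) - ((n - u - k) choose (k - u))) + 3 * \<delta>"
    by (rule weight_card_le) (use finX card in auto)
  moreover have "weight n k u * real (((n - u) choose (k - u)) - ((n - u - k) choose (k - u))) \<le> 80 / 81"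
  proof -
    have "0 < (n - u) choose (k - u)" using u_le n_ge by (simp add: zero_less_binomial_iff)
    moreover have "(n - u - k) choose (k - u) \<le> (n - u) choose (k - u)" by (rule binomial_right_mono) simp
    ultimately show ?thesis
      using avoiding_estimate[OF u_le] unfolding weight_def by (simp add: of_nat_diff divide_le_eq)
  qed
  ultimately show "weight n k u * real (card upper) \<le> 80 / 81 + 3 * \<delta>" by linarith
qed

text \<open>Both hypotheses together force every level to be \<open>u\<close>, so the sum is the
  proportion of the star that \<open>F\<close> fills.\<close>

lemma contained_in_star:
  assumes star: "\<And>B. B \<in> F \<Longrightarrow> {1..u} \<subseteq> B" and low: "\<And>B. B \<in> F \<Longrightarrow> min_inter F B \<le> u"
  shows "level_sum n k F \<le> 1" "level_sum n k F = 1 \<Longrightarrow> is_star n k u F"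
proof -
  have un: "u \<le> n" using u_le n_ge by simp
  let ?X = "{A \<in> nsets {1..n} k. {1..u} \<subseteq> A}"
  have FX: "F \<subseteq> ?X" using star F by auto
  have finX: "finite ?X" using finite_imp_finite_nsets[of "{1..n}" k] by auto
  have cX: "card ?X = (n - u) choose (k - u)" using card_supersets[of "{1..n}" "{1..u}" k] u_le un by auto
  have "min_inter F A = u" if "A \<in> F" for A
  proof (rule antisym[OF low[OF that]])
    have "u \<le> card (A \<inter> B)" if "B \<in> F" for B
    proof -
      have "{1..u} \<subseteq> A \<inter> B" using star that \<open>A \<in> F\<close> by blast
      moreover have "finite (A \<inter> B)" using that F by (auto simp: nsets_def)
      ultimately show ?thesis using card_mono[of "A \<inter> B" "{1..u}"] by simp
    qed
    then show "u \<le> min_inter F A" by (simp add: le_level_iff)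
  qed
  then have sum: "level_sum n k F = real (card F) / real ((n - u) choose (k - u))"
    by (simp add: level_sum_def weight_def)
  have pos: "0 < (n - u) choose (k - u)" using u_le n_ge by (simp add: zero_less_binomial_iff)
  have "card F \<le> (n - u) choose (k - u)" using card_mono[OF finX FX] cX by simp
  then show "level_sum n k F \<le> 1" using pos by (simp add: sum)
  assume "level_sum n k F = 1"
  then have "card F = card ?X" using pos cX by (simp add: sum)
  then have "F = ?X" using card_subset_eq[OF finX FX] by simp
  then show "is_star n k u F" using un unfolding is_star_def by (intro exI[of _ "{1..u}"]) auto
qed

lemma level_sum_le_1: "level_sum n k F \<le> 1 \<and> (level_sum n k F = 1 \<longrightarrow> (\<exists>c\<le>k. is_star n k c F))"
proof (cases "\<forall>A\<in>upper. revisits 0 u A")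
  case True
  then show ?thesis using all_revisit by simp
next
  case False
  then obtain A0 where A0: "A0 \<in> upper" "\<not> revisits 0 u A0" by blast
  obtain r where r: "u + r \<le> k"
    and visit: "\<And>B. B \<in> F \<Longrightarrow> reaches 0 (Suc u) B \<or> card (B \<inter> {..u + 2 * r}) = u + r"
    using common_visit[OF A0] by blast
  let ?Y = "{A \<in> nsets {1..n} k. card (A \<inter> {..u + 2 * r}) = u + r}"
  have finY: "finite ?Y" using finite_imp_finite_nsets[of "{1..n}" k] by auto
  have FY: "F \<subseteq> {A \<in> F. reaches 0 (Suc u) A} \<union> ?Y" using visit F by blast
  have "u + 2 * r - r = u + r" by simp
  then have eq: "u + 2 * r choose (u + r) = (u + 2 * r choose r)"
    using binomial_symmetric[of r "u + 2 * r"] by (metis le_add2 mult_2 add.assoc)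
  have "u + 2 * r \<le> n" using r n_ge by simp
  then have cY: "card ?Y \<le> (u + 2 * r choose r) * ((n - (u + 2 * r)) choose (k - (u + r)))"
    using card_prefix_eq[of "u + 2 * r" n "u + r" k] r eq by simp
  note bound = weight_card_le[OF _ finY cY]
  consider "r = 0" | "r = 1" | "2 \<le> r" by linarith
  then show ?thesis
  proof cases
    case 1
    have start: "reaches 0 (Suc u) B \<or> {1..u} \<subseteq> B" if "B \<in> F" for B
    proof (cases "reaches 0 (Suc u) B")
      case False
      then have c: "card (B \<inter> {..u}) = u" using visit[OF that] 1 by simp
      have "B \<subseteq> {1..n}" using that F unfolding nsets_def by blast
      then have "B \<inter> {..u} \<subseteq> {1..u}" by auto
      then have "B \<inter> {..u} = {1..u}" using c by (intro card_subset_eq) auto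
      then show ?thesis by blast
    qed simp
    show ?thesis
    proof (cases "(\<forall>B\<in>F. {1..u} \<subseteq> B) \<and> (\<forall>B\<in>F. min_inter F B \<le> u)")
      case True
      then show ?thesis using contained_in_star u_le by blast
    next
      case False
      then obtain B where B: "B \<in> F" "\<not> {1..u} \<subseteq> B \<or> ({1..u} \<subseteq> B \<and> u < min_inter F B)"
        by (meson not_le)
      \<comment> \<open>Otherwise \<open>A \<inter> B\<close> would be exactly
        \<open>{1..u}\<close>, which contradicts either way in which \<open>B\<close> was
        chosen.\<close>
      have "\<not> A \<inter> B \<subseteq> {1..u}" if A: "A \<in> upper" "{1..u} \<subseteq> A" for A
      proof
        assume sub: "A \<inter> B \<subseteq> {1..u}"
        have "u \<le> card (A \<inter> B)" using A B le_level_iff by blast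
        moreover have "card (A \<inter> B) \<le> u" using card_mono[OF _ sub] by simp
        ultimately have "A \<inter> B = {1..u}" using sub by (intro card_subset_eq) auto
        then have "{1..u} \<subseteq> B" by blast
        then have "Suc u \<le> card (B \<inter> A)" using B A le_level_iff[of "Suc u" B] by auto
        then show False using \<open>card (A \<inter> B) \<le> u\<close> by (simp add: Int_commute)
      qed
      then have "level_sum n k F < 1" using visit_at_start[of B] start B F by blast
      then show ?thesis by simp
    qed
  next
    case 2
    \<comment> \<open>\<open>?y\<close> bounds the weighted size of all of \<open>F\<close> and so
      serves level \<open>u\<close> and the lower levels alike. The constant 3 of
      \<open>weight_card_F\<close> would lead to \<open>(u + 11) * (k - u)\<close>, too much for the
      linear term in \<open>n_large\<close>.\<close>
    let ?y = "(real u + 2) * real (k - u) / (m + real (k - u)) + 3 * \<delta>"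
    have "weight n k u * real (card F) \<le>
        weight n k u * real ((u + 2 choose 1) * ((n - (u + 2)) choose (k - (u + 1)))) + 3 * \<delta>"
      using bound[OF FY] 2 by simp
    also have "\<dots> \<le> (real u + 2) * real (k - u) / real (n - u) + 3 * \<delta>"
      using weight_prefix_one[of u] r 2 by simp
    also have "real (n - u) = m + real (k - u)" using u_le n_ge by (simp add: of_nat_diff)
    finally have y: "weight n k u * real (card F) \<le> ?y" .
    have "card upper \<le> card F" using finF by (intro card_mono) auto
    then have "weight n k u * real (card upper) \<le> weight n k u * real (card F)"
      using weight_pos[OF u_le] by (intro mult_left_mono) auto
    then have "weight n k u * real (card upper) \<le> ?y" using y by linarith
    moreover have "weight n k u * real (card F) * ((real (k - u) + 1) / m) \<le> ?y * ((real (k - u) + 1) / m)"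
      using y m_pos by (intro mult_right_mono) auto
    moreover have "?y + ?y * ((real (k - u) + 1) / m) + 3 * \<delta> / (1 - \<delta>) < 1"
    proof (rule critical_case_estimate)
      have "real u + real (k - u) = real k" using u_le by (simp add: of_nat_diff)
      then show "(real u + real (k - u))\<^sup>2 / 4 + 4 * (real u + real (k - u)) + 100 \<le> m"
        using m_large by simp
    qed (use r 2 in auto)
    ultimately have "level_sum n k F < 1" using level_sum_bound by linarith
    then show ?thesis by simp
  next
    case 3
    have "weight n k u * real (card upper)
        \<le> weight n k u * real ((u + 2 * r choose r) * ((n - (u + 2 * r)) choose (k - (u + r)))) + 3 * \<delta>"
      using FY by (intro bound) blast
    also have "\<dots> \<le> 1 / 2 + 3 * \<delta>" using weight_prefix_ge_two[OF r 3] by simp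
    finally have "level_sum n k F < 1" by (intro level_sum_less_1) simp
    then show ?thesis by simp
  qed
qed

end

context large_ground_set
begin

lemma shifted_case:
  assumes F: "F \<subseteq> nsets {1..n} k" and shifted: "left_shifted F"
  shows "level_sum n k F \<le> 1 \<and> (level_sum n k F = 1 \<longrightarrow> (\<exists>c\<le>k. is_star n k c F))"
proof (cases "F = {}")
  case False
  interpret shifted_family n k F by unfold_locales (fact F shifted)+
  obtain u B where u: "\<forall>A\<in>F. reaches 0 u A" "B \<in> F" "\<not> reaches 0 (Suc u) B"
    using exists_critical_height[OF False] by blast
  interpret critical_family n k F u B by unfold_locales (use u in auto)
  show ?thesis by (rule level_sum_le_1)
qed (simp add: level_sum_def)

lemma level_sum_le_1_iff_star:
  assumes "F \<subseteq> nsets {1..n} k"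
  shows "level_sum n k F \<le> 1 \<and> (level_sum n k F = 1 \<longleftrightarrow> (\<exists>c\<le>k. is_star n k c F))"
  using reduction_to_shifted[OF shifted_case assms] level_sum_star[of n k _ F] n_ge by fastforce

end

theorem theorem1p2:
  shows "\<exists>D::real. \<forall>(k::nat) (n::nat) (F::nat set set).
    k \<ge> 1 \<longrightarrow> F \<subseteq> nsets {1..n} k \<longrightarrow> real n \<ge> (real k)^2 / 4 + 5 * real k + D \<longrightarrow>
      (\<Sum>A\<in>F. 1 / real ((n - min_inter F A) choose (k - min_inter F A))) \<le> 1 \<and>
      ((\<Sum>A\<in>F. 1 / real ((n - min_inter F A) choose (k - min_inter F A))) = 1
        \<longleftrightarrow> (\<exists>c\<le>k. is_star n k c F))"
proof (intro exI[of _ 10000000] allI impI)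
  fix k n :: nat and F :: "nat set set"
  assume k: "1 \<le> k" and F: "F \<subseteq> nsets {1..n} k" and n: "(real k)\<^sup>2 / 4 + 5 * real k + 10000000 \<le> real n"
  interpret large_ground_set n k by unfold_locales (fact k n)+
  show "(\<Sum>A\<in>F. 1 / real ((n - min_inter F A) choose (k - min_inter F A))) \<le> 1 \<and>
      ((\<Sum>A\<in>F. 1 / real ((n - min_inter F A) choose (k - min_inter F A))) = 1
        \<longleftrightarrow> (\<exists>c\<le>k. is_star n k c F))"
    using level_sum_le_1_iff_star[OF F] by (simp only: level_sum_def weight_def)
qed

end
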